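(* Let $\alpha\in[0,1]$. There is a constant $C>0$ such that the following hold. (a) If $A\in\mathcal M_{\widehat\alpha+}$ and $B\in\mathcal M_{\widehat\alpha}$, then $AB,BA\in\mathcal M_{\widehat\alpha}$, with $\|AB\|_{\widehat\alpha},\|BA\|_{\widehat\alpha}\le C\|A\|_{\widehat\alpha+}\|B\|_{\widehat\alpha}$. (b) If $A,B\in\mathcal M_{\widehat\alpha+}$, then $AB\in\mathcal M_{\widehat\alpha+}$, with $\|AB\|_{\widehat\alpha+}\le C\|A\|_{\widehat\alpha+}\|B\|_{\widehat\alpha+}$. (c) If $A\in\mathcal M_+$, then for all $s\in[-2,2]$ we have $A\in\mathcal B(\ell^2_s)$, with $\|A\|_{\mathcal B(\ell^2_s)}\le C\|A\|_+$. (d) Let $A=\mathrm{diag}\{d_1,d_2,d_3,\dots\}$. If $\Delta A\in\mathcal M_\alpha$, then $|d_i-d_j|\le|\Delta A|_\alpha\dfrac{|i-j|}{(i\wedge j)^\alpha}$ for all $i,j\in\mathbb N$.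
   Context: $\mathbb N=\{1,2,\dots\}$, $i\wedge j=\min\{i,j\}$. $\ell^2_s$ for $s\in\mathbb R$ is the space of complex sequences $u=(u_i)_{i\ge1}$ with $\|u\|_s:=(\sum_{i\ge1}i^s|u_i|^2)^{1/2}<\infty$ (for $s<0$ it is identified with the dual of $\ell^2_{-s}$); $\ell^2=\ell^2_0$. For an infinite complex matrix $A=(A_i^j)_{i,j\in\mathbb N}$, acting by $(Au)_i=\sum_{j}A_i^ju_j$: $\|A\|$ is the operator norm on $\ell^2$ and $\mathcal M:=\mathcal B(\ell^2)$. $\mathcal N:=\mathrm{diag}\{1,2,3,\dots\}$, so $[\mathcal N,A]$ is the matrix with entries $(i-j)A_i^j$. The difference matrix is $(\Delta A)_i^j:=A_{i+1}^{j+1}-A_i^j$. - $\mathcal M_+:=\{A\in\mathcal M:\|[\mathcal N,A]\|<\infty\}$, with $\|A\|_+:=\max\{\|A\|,\|[\mathcal N,A]\|\}$. - $\mathcal M_\alpha$: matrices with $|A|_\alpha:=\sup_{i,j\ge1}(i\wedge j)^\alpha|A_i^j|<\infty$. - $\mathcal M_{\alpha+}:=\{A\in\mathcal M_\alpha:|[\mathcal N,A]|_\alpha<\infty\}$, with $|A|_{\alpha+}:=\max\{|A|_\alpha,|[\mathcal N,A]|_\alpha\}$. - $\mathcal M_{\widehat\alpha}:=\{A\in\mathcal M:\Delta A\in\mathcal M_\alpha\}$, with $\|A\|_{\widehat\alpha}:=\max\{\|A\|,|\Delta A|_\alpha\}$. - $\mathcal M_{\widehat\alpha+}:=\{A\in\mathcal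 M_+:\Delta A\in\mathcal M_{\alpha+}\}$, with $\|A\|_{\widehat\alpha+}:=\max\{\|A\|,\|[\mathcal N,A]\|,|\Delta A|_\alpha,|[\mathcal N,\Delta A]|_\alpha\}$. *)

theory Defs
  imports "HOL-Analysis.Analysis"
begin

(* Indices run over {1..}. Sequences and matrices are functions on nat whose
   values at index 0 are ignored by every definition below. *)

type_synonym cseq = "nat \<Rightarrow> complex"
type_synonym cmat = "nat \<Rightarrow> nat \<Rightarrow> complex"  \<comment> \<open>\<open>A i j\<close> is the entry in row \<open>i\<close>, column \<open>j\<close>\<close>

definition ell2 :: "real \<Rightarrow> cseq set" where
  "ell2 s = {u. (\<lambda>i. real i powr s * (cmod (u i))\<^sup>2) summable_on {1..}}"

definition ell2_norm :: "real \<Rightarrow> cseq \<Rightarrow> real" where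
  "ell2_norm s u = sqrt (\<Sum>\<^sub>\<infinity>i\<in>{1..}. real i powr s * (cmod (u i))\<^sup>2)"

definition mat_app :: "cmat \<Rightarrow> cseq \<Rightarrow> cseq" where
  "mat_app A u = (\<lambda>i. \<Sum>\<^sub>\<infinity>j\<in>{1..}. A i j * u j)"

(* For A and B in B(ell2) the defining series converges absolutely by Cauchy-Schwarz. *)
definition mat_mult :: "cmat \<Rightarrow> cmat \<Rightarrow> cmat" where
  "mat_mult A B = (\<lambda>i j. \<Sum>\<^sub>\<infinity>k\<in>{1..}. A i k * B k j)"

(* The matrices A in B(ell2 s). Convergence of the series defining A u is required explicitly,
   since infsum is 0 on families that are not summable. Asking for unconditional convergence is no
   restriction: ell2 s is closed under multiplication by unimodular sequences. *)
definition bounded_mats :: "real \<Rightarrow> cmat set" where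
  "bounded_mats s = {A.
     (\<forall>u\<in>ell2 s. (\<forall>i\<ge>1. (\<lambda>j. A i j * u j) summable_on {1..}) \<and> mat_app A u \<in> ell2 s) \<and>
     (\<exists>K. \<forall>u\<in>ell2 s. ell2_norm s (mat_app A u) \<le> K * ell2_norm s u)}"

(* Each real-valued norm below is meaningful only on the corresponding set of matrices: Sup is
   unspecified on sets that are not bounded above. *)
definition op_norm :: "real \<Rightarrow> cmat \<Rightarrow> real" where
  "op_norm s A = (SUP u\<in>{u \<in> ell2 s. ell2_norm s u \<le> 1}. ell2_norm s (mat_app A u))"

definition comm_N :: "cmat \<Rightarrow> cmat" where
  "comm_N A = (\<lambda>i j. (of_nat i - of_nat j) * A i j)"

definition Delta :: "cmat \<Rightarrow> cmat" where
  "Delta A = (\<lambda>i j. A (i + 1) (j + 1) - A i j)"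

definition diag_mat :: "cseq \<Rightarrow> cmat" where
  "diag_mat d = (\<lambda>i j. if i = j then d i else 0)"

definition M :: "cmat set" where
  "M = bounded_mats 0"

definition M_plus :: "cmat set" where
  "M_plus = {A \<in> M. comm_N A \<in> M}"

definition norm_plus :: "cmat \<Rightarrow> real" where
  "norm_plus A = max (op_norm 0 A) (op_norm 0 (comm_N A))"

definition M_alpha :: "real \<Rightarrow> cmat set" where
  "M_alpha \<alpha> = {A. bdd_above ((\<lambda>(i, j). real (min i j) powr \<alpha> * cmod (A i j)) ` ({1..} \<times> {1..}))}"

definition norm_alpha :: "real \<Rightarrow> cmat \<Rightarrow> real" where
  "norm_alpha \<alpha> A = (SUP (i, j)\<in>{1..} \<times> {1..}. real (min i j) powr \<alpha> * cmod (A i j))"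

definition M_alpha_plus :: "real \<Rightarrow> cmat set" where
  "M_alpha_plus \<alpha> = {A \<in> M_alpha \<alpha>. comm_N A \<in> M_alpha \<alpha>}"

definition norm_alpha_plus :: "real \<Rightarrow> cmat \<Rightarrow> real" where
  "norm_alpha_plus \<alpha> A = max (norm_alpha \<alpha> A) (norm_alpha \<alpha> (comm_N A))"

definition M_hat :: "real \<Rightarrow> cmat set" where
  "M_hat \<alpha> = {A \<in> M. Delta A \<in> M_alpha \<alpha>}"

definition norm_hat :: "real \<Rightarrow> cmat \<Rightarrow> real" where
  "norm_hat \<alpha> A = max (op_norm 0 A) (norm_alpha \<alpha> (Delta A))"

definition M_hat_plus :: "real \<Rightarrow> cmat set" where
  "M_hat_plus \<alpha> = {A \<in> M_plus. Delta A \<in> M_alpha_plus \<alpha>}"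

definition norm_hat_plus :: "real \<Rightarrow> cmat \<Rightarrow> real" where
  "norm_hat_plus \<alpha> A = max (norm_plus A) (norm_alpha_plus \<alpha> (Delta A))"

end

theory Submission
  imports Defs
begin

text \<open>The difference of a product obeys a discrete Leibniz rule,
  \<open>\<Delta>(AB)\<^sub>i\<^sub>j = A\<^sub>i\<^sub>+\<^sub>1\<^sub>,\<^sub>1 B\<^sub>1\<^sub>,\<^sub>j\<^sub>+\<^sub>1 + \<Sum>\<^sub>k (A\<^sub>i\<^sub>+\<^sub>1\<^sub>,\<^sub>k\<^sub>+\<^sub>1 (\<Delta>B)\<^sub>k\<^sub>j + (\<Delta>A)\<^sub>i\<^sub>k B\<^sub>k\<^sub>j)\<close>. Since
  \<open>min(i,j)\<^sup>\<alpha> \<le> (1 + \<bar>i - k\<bar>/k) min(k,j)\<^sup>\<alpha>\<close>, each term is controlled by the Cauchy-Schwarz inequality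
  together with the square summability of \<open>1/k\<close> and \<open>1/(1 + \<bar>i - k\<bar>)\<close>; the factor \<open>\<bar>i - k\<bar>\<close> is absorbed by the
  commutator of \<open>A\<close> with \<open>\<N>\<close>. Only the norms of rows and columns enter, so transposition turns the
  estimate for \<open>AB\<close> into the one for \<open>BA\<close>. Part (b) is (a) applied to \<open>[\<N>,AB] = [\<N>,A]B + A[\<N>,B]\<close>,
  because the commutator and \<open>\<Delta>\<close> commute.

  For (c), conjugating \<open>A\<close> with \<open>\<N>\<close> gives \<open>\<N>A\<N>\<^sup>-\<^sup>1 = A + [\<N>,A]\<N>\<^sup>-\<^sup>1\<close> and
  \<open>\<N>\<^sup>-\<^sup>1A\<N> = A - \<N>\<^sup>-\<^sup>1[\<N>,A]\<close>, hence boundedness for \<open>s = 2\<close> and \<open>s = -2\<close>. The values in between follow by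
  quadratic interpolation: \<open>\<integral> \<mu>\<^sup>-\<^sup>\<theta>\<^sup>-\<^sup>1 \<mu>x/(1 + \<mu>x) d\<mu>\<close> over the positive half-line is a constant times \<open>x\<^sup>\<theta>\<close>, and the
  integrand is the K-functional of the two endpoint spaces.\<close>

section \<open>Weighted sequence spaces\<close>

text \<open>Norm estimates are carried out on finite sections, where \<open>L2_set\<close> supplies
  Minkowski and Cauchy-Schwarz; \<open>ell2_bound\<close> is the way back. The exponent is
  \<open>s/2\<close> because the weight is moved inside the square.\<close>

lemma ell2_L2_le:
  assumes "u \<in> ell2 s" "finite F" "F \<subseteq> {1..}"
  shows "L2_set (\<lambda>i. real i powr (s/2) * cmod (u i)) F \<le> ell2_norm s u"
proof -
  have "(\<Sum>i\<in>F. (real i powr (s/2) * cmod (u i))\<^sup>2) = (\<Sum>i\<in>F. real i powr s * (cmod (u i))\<^sup>2)"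
    by (rule sum.cong) (auto simp: power_mult_distrib power2_eq_square simp flip: powr_add)
  also have "\<dots> \<le> (\<Sum>\<^sub>\<infinity>i\<in>{1..}. real i powr s * (cmod (u i))\<^sup>2)"
    using assms by (intro finite_sum_le_infsum) (auto simp: ell2_def)
  finally show ?thesis
    by (simp add: L2_set_def ell2_norm_def)
qed

lemma ell2_bound:
  assumes "K \<ge> 0"
    and "\<And>F. finite F \<Longrightarrow> F \<subseteq> {1..} \<Longrightarrow> L2_set (\<lambda>i. real i powr (s/2) * cmod (u i)) F \<le> K"
  shows "u \<in> ell2 s" and "ell2_norm s u \<le> K"
proof -
  have *: "(\<Sum>i\<in>F. real i powr s * (cmod (u i))\<^sup>2) \<le> K\<^sup>2" if "finite F" "F \<subseteq> {1..}" for F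
  proof -
    have "(\<Sum>i\<in>F. real i powr s * (cmod (u i))\<^sup>2) = (\<Sum>i\<in>F. (real i powr (s/2) * cmod (u i))\<^sup>2)"
      by (rule sum.cong) (auto simp: power_mult_distrib power2_eq_square simp flip: powr_add)
    also have "\<dots> = (L2_set (\<lambda>i. real i powr (s/2) * cmod (u i)) F)\<^sup>2"
      by (simp add: L2_set_def sum_nonneg)
    also have "\<dots> \<le> K\<^sup>2"
      using assms(2)[OF that] by (intro power_mono) auto
    finally show ?thesis .
  qed
  show u: "u \<in> ell2 s"
    unfolding ell2_def mem_Collect_eq
    by (rule nonneg_bdd_above_summable_on) (use * in \<open>auto intro!: bdd_aboveI\<close>)
  have "(\<Sum>\<^sub>\<infinity>i\<in>{1..}. real i powr s * (cmod (u i))\<^sup>2) \<le> K\<^sup>2"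
    using u * by (intro infsum_le_finite_sums) (auto simp: ell2_def)
  then show "ell2_norm s u \<le> K"
    unfolding ell2_norm_def using assms(1) by (simp add: real_le_lsqrt)
qed

lemma ell2_norm_nonneg [simp]: "ell2_norm s u \<ge> 0"
  by (auto simp: ell2_norm_def intro!: infsum_nonneg)

lemma ell2_nth_le:
  assumes "u \<in> ell2 0" "i \<ge> 1"
  shows "cmod (u i) \<le> ell2_norm 0 u"
  using ell2_L2_le[OF assms(1), of "{i}"] assms(2) by simp

lemma ell2_0_L2_le:
  assumes "u \<in> ell2 0" "finite F" "F \<subseteq> {1..}"
  shows "L2_set (\<lambda>i. cmod (u i)) F \<le> ell2_norm 0 u"
proof -
  have "L2_set (\<lambda>i. cmod (u i)) F = L2_set (\<lambda>i. real i powr (0/2) * cmod (u i)) F"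
    using assms(3) by (intro L2_set_cong) auto
  with ell2_L2_le[OF assms] show ?thesis by simp
qed

lemma ell2_0_bound:
  assumes "K \<ge> 0"
    and "\<And>F. finite F \<Longrightarrow> F \<subseteq> {1..} \<Longrightarrow> L2_set (\<lambda>i. cmod (u i)) F \<le> K"
  shows "u \<in> ell2 0" and "ell2_norm 0 u \<le> K"
proof -
  have "L2_set (\<lambda>i. real i powr (0/2) * cmod (u i)) F \<le> K" if "finite F" "F \<subseteq> {1..}" for F
  proof -
    have "L2_set (\<lambda>i. real i powr (0/2) * cmod (u i)) F = L2_set (\<lambda>i. cmod (u i)) F"
      using that(2) by (intro L2_set_cong) auto
    with assms(2)[OF that] show ?thesis by simp
  qed
  from ell2_bound[OF assms(1) this] show "u \<in> ell2 0" "ell2_norm 0 u \<le> K" by blast+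
qed

lemma ell2_add:
  assumes "u \<in> ell2 s" "v \<in> ell2 s"
  shows "(\<lambda>i. u i + v i) \<in> ell2 s"
    and "ell2_norm s (\<lambda>i. u i + v i) \<le> ell2_norm s u + ell2_norm s v"
proof -
  have "L2_set (\<lambda>i. real i powr (s/2) * cmod (u i + v i)) F \<le> ell2_norm s u + ell2_norm s v"
    if F: "finite F" "F \<subseteq> {1..}" for F
  proof -
    have "L2_set (\<lambda>i. real i powr (s/2) * cmod (u i + v i)) F
        \<le> L2_set (\<lambda>i. real i powr (s/2) * cmod (u i) + real i powr (s/2) * cmod (v i)) F"
      by (intro L2_set_mono) (auto simp: norm_triangle_ineq mult_left_mono simp flip: distrib_left)
    also have "\<dots> \<le> L2_set (\<lambda>i. real i powr (s/2) * cmod (u i)) F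
        + L2_set (\<lambda>i. real i powr (s/2) * cmod (v i)) F"
      by (rule L2_set_triangle_ineq)
    also have "\<dots> \<le> ell2_norm s u + ell2_norm s v"
      using ell2_L2_le assms F by (intro add_mono) auto
    finally show ?thesis .
  qed
  from ell2_bound[OF _ this] show "(\<lambda>i. u i + v i) \<in> ell2 s"
    "ell2_norm s (\<lambda>i. u i + v i) \<le> ell2_norm s u + ell2_norm s v" by auto
qed

lemma ell2_norm_cmult: "ell2_norm s (\<lambda>i. c * u i) = cmod c * ell2_norm s u"
proof -
  have "(\<Sum>\<^sub>\<infinity>i\<in>{1..}. real i powr s * (cmod (c * u i))\<^sup>2)
      = (\<Sum>\<^sub>\<infinity>i\<in>{1..}. (cmod c)\<^sup>2 * (real i powr s * (cmod (u i))\<^sup>2))"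
    by (rule infsum_cong) (simp add: norm_mult power_mult_distrib)
  also have "\<dots> = (cmod c)\<^sup>2 * (\<Sum>\<^sub>\<infinity>i\<in>{1..}. real i powr s * (cmod (u i))\<^sup>2)"
    by (rule infsum_cmult_right')
  finally show ?thesis
    by (simp add: ell2_norm_def real_sqrt_mult)
qed

lemma ell2_cmult:
  assumes "u \<in> ell2 s" shows "(\<lambda>i. c * u i) \<in> ell2 s"
proof -
  have "(\<lambda>i. (cmod c)\<^sup>2 * (real i powr s * (cmod (u i))\<^sup>2)) summable_on {1..}"
    using assms by (intro summable_on_cmult_right) (simp add: ell2_def)
  then show ?thesis
    by (simp add: ell2_def norm_mult power_mult_distrib mult.left_commute)
qed

lemma ell2_cong:
  assumes "\<And>i. i \<ge> 1 \<Longrightarrow> u i = v i"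
  shows "u \<in> ell2 s \<longleftrightarrow> v \<in> ell2 s" and "ell2_norm s u = ell2_norm s v"
  using assms by (auto simp: ell2_def ell2_norm_def intro!: summable_on_cong infsum_cong)

text \<open>The weights on the two sides may differ, so that multiplication and division by the
  index become bounded maps between \<open>ell2 2\<close>, \<open>ell2 0\<close> and
  \<open>ell2 (-2)\<close>.\<close>

lemma ell2_mono:
  assumes "v \<in> ell2 t"
    and "\<And>i. i \<ge> 1 \<Longrightarrow> real i powr (s/2) * cmod (u i) \<le> real i powr (t/2) * cmod (v i)"
  shows "u \<in> ell2 s" and "ell2_norm s u \<le> ell2_norm t v"
proof -
  have "L2_set (\<lambda>i. real i powr (s/2) * cmod (u i)) F \<le> ell2_norm t v"
    if F: "finite F" "F \<subseteq> {1..}" for F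
    using F assms(2) by (intro order.trans[OF L2_set_mono ell2_L2_le[OF assms(1) F]]) auto
  from ell2_bound[OF _ this] show "u \<in> ell2 s" "ell2_norm s u \<le> ell2_norm t v" by auto
qed

lemma ell2_subset:
  assumes "u \<in> ell2 t" "s \<le> t"
  shows "u \<in> ell2 s" and "ell2_norm s u \<le> ell2_norm t u"
proof -
  have "real i powr (s/2) * cmod (u i) \<le> real i powr (t/2) * cmod (u i)" if "i \<ge> 1" for i
    using assms(2) that by (intro mult_right_mono powr_mono) auto
  from ell2_mono[OF assms(1) this] show "u \<in> ell2 s" "ell2_norm s u \<le> ell2_norm t u" by auto
qed

lemma summable_infsum_bound:
  fixes f :: "'a \<Rightarrow> complex"
  assumes "\<And>F. finite F \<Longrightarrow> F \<subseteq> S \<Longrightarrow> (\<Sum>k\<in>F. cmod (f k)) \<le> K"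
  shows "f summable_on S" and "cmod (infsum f S) \<le> K"
proof -
  have abs: "(\<lambda>k. cmod (f k)) summable_on S"
    by (rule nonneg_bdd_above_summable_on) (use assms in \<open>auto intro!: bdd_aboveI\<close>)
  then show "f summable_on S"
    by (rule abs_summable_summable)
  have "cmod (infsum f S) \<le> (\<Sum>\<^sub>\<infinity>k\<in>S. cmod (f k))"
    by (rule norm_infsum_bound[OF abs])
  also have "\<dots> \<le> K"
    using abs assms by (intro infsum_le_finite_sums) auto
  finally show "cmod (infsum f S) \<le> K" .
qed

lemma ell2_cauchy_schwarz:
  assumes "u \<in> ell2 0" "v \<in> ell2 0"
  shows "(\<lambda>k. u k * v k) summable_on {1..}"
    and "cmod (\<Sum>\<^sub>\<infinity>k\<in>{1..}. u k * v k) \<le> ell2_norm 0 u * ell2_norm 0 v"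
proof -
  have *: "(\<Sum>k\<in>F. cmod (u k * v k)) \<le> ell2_norm 0 u * ell2_norm 0 v"
    if F: "finite F" "F \<subseteq> {1..}" for F
  proof -
    have "(\<Sum>k\<in>F. cmod (u k * v k)) \<le> L2_set (\<lambda>k. cmod (u k)) F * L2_set (\<lambda>k. cmod (v k)) F"
      using L2_set_mult_ineq[of "\<lambda>k. cmod (u k)" "\<lambda>k. cmod (v k)" F] by (simp add: norm_mult)
    also have "\<dots> \<le> ell2_norm 0 u * ell2_norm 0 v"
      using assms F by (intro mult_mono ell2_0_L2_le) (auto simp: L2_set_nonneg)
    finally show ?thesis .
  qed
  from summable_infsum_bound[OF this] show "(\<lambda>k. u k * v k) summable_on {1..}"
    "cmod (\<Sum>\<^sub>\<infinity>k\<in>{1..}. u k * v k) \<le> ell2_norm 0 u * ell2_norm 0 v" by blast+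
qed

section \<open>Bounded matrices\<close>

text \<open>An explicit constant replaces the supremum in \<open>op_norm\<close>, so that bounds can
  be added, multiplied and weakened freely. The passage in both directions is
  \<open>op_norm_le\<close> and \<open>op_bound_op_norm\<close>.\<close>

definition op_bound :: "real \<Rightarrow> real \<Rightarrow> cmat \<Rightarrow> bool" where
  "op_bound s K A \<longleftrightarrow> K \<ge> 0 \<and> (\<forall>u\<in>ell2 s.
     (\<forall>i\<ge>1. (\<lambda>j. A i j * u j) summable_on {1..}) \<and> mat_app A u \<in> ell2 s \<and>
     ell2_norm s (mat_app A u) \<le> K * ell2_norm s u)"

lemma zero_in_ell2: "(\<lambda>i. 0) \<in> ell2 s" and ell2_norm_zero: "ell2_norm s (\<lambda>i. 0) = 0"
  by (auto simp: ell2_def ell2_norm_def)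

lemma op_norm_le:
  assumes "op_bound s K A"
  shows "A \<in> bounded_mats s" and "op_norm s A \<le> K"
proof -
  show "A \<in> bounded_mats s"
    using assms by (auto simp: bounded_mats_def op_bound_def)
  show "op_norm s A \<le> K"
    unfolding op_norm_def
  proof (rule cSUP_least)
    show "{u \<in> ell2 s. ell2_norm s u \<le> 1} \<noteq> {}"
      using zero_in_ell2 ell2_norm_zero by fastforce
    fix u assume "u \<in> {u \<in> ell2 s. ell2_norm s u \<le> 1}"
    then have "ell2_norm s (mat_app A u) \<le> K * ell2_norm s u" "K * ell2_norm s u \<le> K * 1"
      using assms by (auto simp: op_bound_def simp del: mult_1_right intro!: mult_left_mono)
    then show "ell2_norm s (mat_app A u) \<le> K" by simp
  qed
qed

lemma mat_app_cmult: "mat_app A (\<lambda>j. c * u j) = (\<lambda>i. c * mat_app A u i)"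
  by (simp add: mat_app_def mult.left_commute[of _ c] infsum_cmult_right')

lemma op_bound_op_norm:
  assumes "A \<in> bounded_mats s"
  shows "op_bound s (op_norm s A) A"
proof -
  obtain K where K: "\<And>u. u \<in> ell2 s \<Longrightarrow> ell2_norm s (mat_app A u) \<le> K * ell2_norm s u"
    using assms by (auto simp: bounded_mats_def)
  have bdd: "bdd_above ((\<lambda>u. ell2_norm s (mat_app A u)) ` {u \<in> ell2 s. ell2_norm s u \<le> 1})"
  proof (rule bdd_aboveI2)
    fix u assume "u \<in> {u \<in> ell2 s. ell2_norm s u \<le> 1}"
    then have "ell2_norm s (mat_app A u) \<le> K * ell2_norm s u" "ell2_norm s u \<le> 1"
      using K by auto
    moreover have "K * ell2_norm s u \<le> \<bar>K\<bar> * 1"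
      using \<open>ell2_norm s u \<le> 1\<close> by (intro mult_mono) auto
    ultimately show "ell2_norm s (mat_app A u) \<le> \<bar>K\<bar>" by simp
  qed
  have unit: "ell2_norm s (mat_app A u) \<le> op_norm s A" if "u \<in> ell2 s" "ell2_norm s u \<le> 1" for u
    unfolding op_norm_def by (rule cSUP_upper[OF _ bdd]) (use that in auto)
  have nonneg: "op_norm s A \<ge> 0"
    using order.trans[OF ell2_norm_nonneg unit[OF zero_in_ell2]] by (simp add: ell2_norm_zero)
  have "ell2_norm s (mat_app A u) \<le> op_norm s A * ell2_norm s u" if u: "u \<in> ell2 s" for u
  proof (cases "ell2_norm s u = 0")
    \<comment> \<open>A sequence of norm 0 cannot be normalised, but the bound by \<open>K\<close>
      forces its image to have norm 0 as well.\<close>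
    case True
    with K[OF u] show ?thesis by simp
  next
    case False
    define r where "r = ell2_norm s u"
    have r: "r > 0" using False ell2_norm_nonneg[of s u] unfolding r_def by linarith
    have "ell2_norm s (mat_app A (\<lambda>j. of_real (1/r) * u j)) \<le> op_norm s A"
      using r u by (intro unit ell2_cmult) (simp_all only: ell2_norm_cmult, simp_all add: r_def norm_divide)
    then show ?thesis
      using r unfolding mat_app_cmult ell2_norm_cmult by (simp add: r_def norm_divide field_simps)
  qed
  then show ?thesis
    using assms nonneg by (auto simp: op_bound_def bounded_mats_def)
qed

lemma mat_app_add:
  assumes "(\<lambda>j. A i j * u j) summable_on {1..}" "(\<lambda>j. A i j * v j) summable_on {1..}"
  shows "mat_app A (\<lambda>j. u j + v j) i = mat_app A u i + mat_app A v i"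
  using infsum_add[OF assms] by (simp add: mat_app_def distrib_left)

lemma op_bound_add:
  assumes "op_bound s K A" "op_bound s L B"
  shows "op_bound s (K + L) (\<lambda>i j. A i j + B i j)"
  unfolding op_bound_def
proof (intro conjI ballI)
  show "K + L \<ge> 0" using assms by (auto simp: op_bound_def)
  fix u assume u: "u \<in> ell2 s"
  have A: "\<And>i. i \<ge> 1 \<Longrightarrow> (\<lambda>j. A i j * u j) summable_on {1..}" "mat_app A u \<in> ell2 s"
      "ell2_norm s (mat_app A u) \<le> K * ell2_norm s u"
    and B: "\<And>i. i \<ge> 1 \<Longrightarrow> (\<lambda>j. B i j * u j) summable_on {1..}" "mat_app B u \<in> ell2 s"
      "ell2_norm s (mat_app B u) \<le> L * ell2_norm s u"
    using assms u by (auto simp: op_bound_def)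
  show "\<forall>i\<ge>1. (\<lambda>j. (A i j + B i j) * u j) summable_on {1..}"
    using A(1) B(1) by (auto simp: distrib_right intro!: summable_on_add)
  have eq: "mat_app (\<lambda>i j. A i j + B i j) u i = mat_app A u i + mat_app B u i" if "i \<ge> 1" for i
    using infsum_add[OF A(1) B(1), OF that that] by (simp add: mat_app_def distrib_right)
  show "mat_app (\<lambda>i j. A i j + B i j) u \<in> ell2 s"
    using ell2_cong(1)[OF eq] ell2_add(1)[OF A(2) B(2)] by simp
  show "ell2_norm s (mat_app (\<lambda>i j. A i j + B i j) u) \<le> (K + L) * ell2_norm s u"
    using ell2_cong(2)[OF eq] ell2_add(2)[OF A(2) B(2)] A(3) B(3)
    by (simp add: distrib_right)
qed

text \<open>Matrices are functions on all of \<open>nat\<close>, whereas identities such as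
  \<open>comm_N_mat_mult\<close> are proved for positive indices.\<close>

lemma op_bound_cong:
  assumes "op_bound s K A" "\<And>i j. i \<ge> 1 \<Longrightarrow> j \<ge> 1 \<Longrightarrow> A i j = B i j"
  shows "op_bound s K B"
proof -
  have sm: "(\<lambda>j. A i j * u j) summable_on {1..} \<longleftrightarrow> (\<lambda>j. B i j * u j) summable_on {1..}"
    if "i \<ge> 1" for i u
    using that assms(2) by (intro summable_on_cong) auto
  have app: "mat_app A u i = mat_app B u i" if "i \<ge> 1" for i u
    using that assms(2) by (auto simp: mat_app_def intro!: infsum_cong)
  show ?thesis
    using assms(1) ell2_cong[OF app] sm by (simp add: op_bound_def)
qed

section \<open>Finite truncations and bounded functionals\<close>

definition unit_seq :: "nat \<Rightarrow> cseq" where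
  "unit_seq j = (\<lambda>i. if i = j then 1 else 0)"

definition restrict_seq :: "nat set \<Rightarrow> cseq \<Rightarrow> cseq" where
  "restrict_seq F u = (\<lambda>i. if i \<in> F then u i else 0)"

lemma restrict_seq_ell2:
  assumes "finite F" "F \<subseteq> {1..}"
  shows "restrict_seq F u \<in> ell2 0" and "ell2_norm 0 (restrict_seq F u) \<le> L2_set (\<lambda>i. cmod (u i)) F"
proof -
  have "L2_set (\<lambda>i. cmod (restrict_seq F u i)) G \<le> L2_set (\<lambda>i. cmod (u i)) F"
    if G: "finite G" "G \<subseteq> {1..}" for G
  proof -
    have "(\<Sum>i\<in>G. (cmod (restrict_seq F u i))\<^sup>2) = (\<Sum>i\<in>G \<inter> F. (cmod (u i))\<^sup>2)"
      using G by (subst sum.inter_restrict) (auto simp: restrict_seq_def intro!: sum.cong)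
    also have "\<dots> \<le> (\<Sum>i\<in>F. (cmod (u i))\<^sup>2)"
      using assms by (intro sum_mono2) auto
    finally show ?thesis by (simp add: L2_set_def)
  qed
  from ell2_0_bound[OF _ this] show "restrict_seq F u \<in> ell2 0"
    "ell2_norm 0 (restrict_seq F u) \<le> L2_set (\<lambda>i. cmod (u i)) F"
    by (auto simp: L2_set_nonneg)
qed

lemma unit_seq_ell2: "j \<ge> 1 \<Longrightarrow> unit_seq j \<in> ell2 0"
  and ell2_norm_unit_seq: "j \<ge> 1 \<Longrightarrow> ell2_norm 0 (unit_seq j) \<le> 1"
  using restrict_seq_ell2[of "{j}" "\<lambda>_. 1"]
  by (auto simp: unit_seq_def restrict_seq_def L2_set_def)

text \<open>The squared norm of the tail is the total sum minus the sum over \<open>F\<close>, which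
  tends to the total along the finite subsets.\<close>

lemma restrict_seq_tendsto:
  assumes "u \<in> ell2 0"
  shows "((\<lambda>F. ell2_norm 0 (\<lambda>i. u i - restrict_seq F u i)) \<longlongrightarrow> 0) (finite_subsets_at_top {1..})"
proof -
  define f where "f = (\<lambda>i. real i powr 0 * (cmod (u i))\<^sup>2)"
  have f: "f summable_on {1..}" using assms by (simp add: ell2_def f_def)
  have eq: "ell2_norm 0 (\<lambda>i. u i - restrict_seq F u i) = sqrt (infsum f {1..} - sum f F)"
    if F: "finite F" "F \<subseteq> {1..}" for F
  proof -
    have "(\<Sum>\<^sub>\<infinity>i\<in>{1..}. real i powr 0 * (cmod (u i - restrict_seq F u i))\<^sup>2) = infsum f ({1..} - F)"
      by (rule infsum_cong_neutral) (use F in \<open>auto simp: f_def restrict_seq_def\<close>)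
    also have "\<dots> = infsum f {1..} - infsum f F"
      using F f by (intro infsum_Diff) auto
    finally show ?thesis
      using F by (simp add: ell2_norm_def)
  qed
  have "((\<lambda>F. sqrt (infsum f {1..} - sum f F)) \<longlongrightarrow> sqrt (infsum f {1..} - infsum f {1..}))
      (finite_subsets_at_top {1..})"
    by (intro tendsto_intros infsum_tendsto f)
  then have "((\<lambda>F. sqrt (infsum f {1..} - sum f F)) \<longlongrightarrow> 0) (finite_subsets_at_top {1..})"
    by simp
  then show ?thesis
    by (rule Lim_transform_eventually) (use eq in \<open>auto intro!: eventually_finite_subsets_at_top_weakI\<close>)
qed

text \<open>On truncated sequences the coefficient formula is finite linearity. A suitable test
  sequence bounds the coefficients, and continuity extends the formula to all of
  \<open>ell2 0\<close>.\<close>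

lemma riesz_ell2:
  fixes f :: "cseq \<Rightarrow> complex"
  assumes K: "K \<ge> 0"
    and bound: "\<And>u. u \<in> ell2 0 \<Longrightarrow> cmod (f u) \<le> K * ell2_norm 0 u"
    and add: "\<And>u v. u \<in> ell2 0 \<Longrightarrow> v \<in> ell2 0 \<Longrightarrow> f (\<lambda>i. u i + v i) = f u + f v"
    and cmult: "\<And>c u. u \<in> ell2 0 \<Longrightarrow> f (\<lambda>i. c * u i) = c * f u"
    and x: "\<And>j. j \<ge> 1 \<Longrightarrow> x j = f (unit_seq j)"
  shows "x \<in> ell2 0" and "ell2_norm 0 x \<le> K"
    and "\<And>u. u \<in> ell2 0 \<Longrightarrow> f u = (\<Sum>\<^sub>\<infinity>j\<in>{1..}. x j * u j)"
proof -
  have fin: "f (restrict_seq F u) = (\<Sum>j\<in>F. x j * u j)" if "finite F" "F \<subseteq> {1..}" for F u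
    using that
  proof (induction F rule: finite_induct)
    case empty
    have "restrict_seq {} u = (\<lambda>i. 0 * (0::complex))" by (simp add: restrict_seq_def)
    with cmult[OF zero_in_ell2, of 0] show ?case by simp
  next
    case (insert j F)
    have "restrict_seq (insert j F) u = (\<lambda>i. u j * unit_seq j i + restrict_seq F u i)"
      using insert by (auto simp: restrict_seq_def unit_seq_def)
    moreover have "restrict_seq F u \<in> ell2 0" using insert by (intro restrict_seq_ell2) auto
    moreover have "unit_seq j \<in> ell2 0" using insert by (intro unit_seq_ell2) auto
    ultimately have "f (restrict_seq (insert j F) u) = u j * f (unit_seq j) + f (restrict_seq F u)"
      by (simp add: add cmult ell2_cmult)
    then show ?case
      using insert x by simp
  qed
  have L2: "L2_set (\<lambda>i. cmod (x i)) F \<le> K" if F: "finite F" "F \<subseteq> {1..}" for F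
  proof -
    let ?L = "L2_set (\<lambda>i. cmod (x i)) F"
    \<comment> \<open>The conjugate of \<open>x\<close>, cut off to \<open>F\<close>, is the
      extremal test sequence: it turns the bound on \<open>f\<close> into
      \<open>?L * ?L \<le> K * ?L\<close>.\<close>
    have "f (restrict_seq F (\<lambda>i. cnj (x i))) = of_real (\<Sum>j\<in>F. (cmod (x j))\<^sup>2)"
      using fin[OF F] by (simp add: complex_norm_square del: of_real_power)
    also have "(\<Sum>j\<in>F. (cmod (x j))\<^sup>2) = ?L\<^sup>2"
      by (simp add: L2_set_def sum_nonneg)
    finally have "?L\<^sup>2 = cmod (f (restrict_seq F (\<lambda>i. cnj (x i))))"
      by (simp add: norm_power)
    also have "\<dots> \<le> K * ell2_norm 0 (restrict_seq F (\<lambda>i. cnj (x i)))"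
      using restrict_seq_ell2[OF F] by (intro bound)
    also have "\<dots> \<le> K * ?L"
      using restrict_seq_ell2(2)[OF F, of "\<lambda>i. cnj (x i)"] K by (intro mult_left_mono) auto
    finally have "?L * ?L \<le> K * ?L" by (simp add: power2_eq_square)
    then show ?thesis
      using K L2_set_nonneg[of "\<lambda>i. cmod (x i)" F] by (cases "?L = 0") auto
  qed
  show x2: "x \<in> ell2 0" and "ell2_norm 0 x \<le> K"
    using ell2_0_bound[OF K L2] by auto
  fix u assume u: "u \<in> ell2 0"
  have "((\<lambda>F. f u - (\<Sum>j\<in>F. x j * u j)) \<longlongrightarrow> 0) (finite_subsets_at_top {1..})"
  proof (rule Lim_null_comparison)
    show "((\<lambda>F. K * ell2_norm 0 (\<lambda>i. u i - restrict_seq F u i)) \<longlongrightarrow> 0) (finite_subsets_at_top {1..})"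
      using restrict_seq_tendsto[OF u] by (rule tendsto_mult_right_zero)
    show "\<forall>\<^sub>F F in finite_subsets_at_top {1..}. norm (f u - (\<Sum>j\<in>F. x j * u j))
        \<le> K * ell2_norm 0 (\<lambda>i. u i - restrict_seq F u i)"
    proof (rule eventually_finite_subsets_at_top_weakI)
      fix F :: "nat set" assume F: "finite F" "F \<subseteq> {1..}"
      let ?r = "restrict_seq F u"
      have r: "?r \<in> ell2 0" by (rule restrict_seq_ell2[OF F])
      have "(\<lambda>i. u i - ?r i) = (\<lambda>i. u i + (-1) * ?r i)" by simp
      then have "(\<lambda>i. u i - ?r i) \<in> ell2 0" "f (\<lambda>i. u i - ?r i) = f u - f ?r"
        using add[OF u ell2_cmult[OF r, of "-1"]] cmult[OF r, of "-1"]
          ell2_add(1)[OF u ell2_cmult[OF r, of "-1"]] by simp_all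
      then show "norm (f u - (\<Sum>j\<in>F. x j * u j)) \<le> K * ell2_norm 0 (\<lambda>i. u i - ?r i)"
        using bound fin[OF F] by metis
    qed
  qed
  from tendsto_diff[OF tendsto_const[of "f u"] this]
  have "((\<lambda>F. \<Sum>j\<in>F. x j * u j) \<longlongrightarrow> f u) (finite_subsets_at_top {1..})"
    by simp
  then have "((\<lambda>j. x j * u j) has_sum f u) {1..}"
    by (simp add: has_sum_def)
  then show "f u = (\<Sum>\<^sub>\<infinity>j\<in>{1..}. x j * u j)"
    by (simp add: infsumI)
qed

lemma op_boundD:
  assumes "op_bound s K A" "u \<in> ell2 s"
  shows "\<And>i. i \<ge> 1 \<Longrightarrow> (\<lambda>j. A i j * u j) summable_on {1..}"
    and "mat_app A u \<in> ell2 s" and "ell2_norm s (mat_app A u) \<le> K * ell2_norm s u" and "K \<ge> 0"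
  using assms by (auto simp: op_bound_def)

lemma mat_app_unit_seq: "j \<ge> 1 \<Longrightarrow> mat_app A (unit_seq j) = (\<lambda>i. A i j)"
proof
  fix i assume j: "j \<ge> 1"
  have "mat_app A (unit_seq j) i = (\<Sum>\<^sub>\<infinity>k\<in>{j}. A i k * unit_seq j k)"
    unfolding mat_app_def by (rule infsum_cong_neutral) (use j in \<open>auto simp: unit_seq_def\<close>)
  then show "mat_app A (unit_seq j) i = A i j" by (simp add: unit_seq_def)
qed

lemma mat_app_cong: "(\<And>j. j \<ge> 1 \<Longrightarrow> u j = v j) \<Longrightarrow> mat_app A u = mat_app A v"
  by (auto simp: mat_app_def intro!: infsum_cong)

section \<open>Products of bounded matrices\<close>

text \<open>This consequence of boundedness is visibly invariant under transposition, and it is all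
  that the estimate of \<open>Delta (mat_mult A B)\<close> asks of operator norms. No adjoint
  operator has to be constructed.\<close>

definition rc_bound :: "real \<Rightarrow> cmat \<Rightarrow> bool" where
  "rc_bound a A \<longleftrightarrow> (\<forall>i\<ge>1. (\<lambda>k. A i k) \<in> ell2 0 \<and> ell2_norm 0 (\<lambda>k. A i k) \<le> a \<and>
     (\<lambda>k. A k i) \<in> ell2 0 \<and> ell2_norm 0 (\<lambda>k. A k i) \<le> a)"

text \<open>Columns are images of unit sequences. Rows are the coefficient sequences of the bounded
  functionals taking \<open>u\<close> to \<open>mat_app A u i\<close>, so \<open>riesz_ell2\<close>
  applies.\<close>

lemma op_bound_imp_rc_bound:
  assumes A: "op_bound 0 K A"
  shows "rc_bound K A"
  unfolding rc_bound_def
proof (intro allI impI)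
  fix i :: nat assume i: "i \<ge> 1"
  have K: "K \<ge> 0" using A by (simp add: op_bound_def)
  have bound: "cmod (mat_app A u i) \<le> K * ell2_norm 0 u" if "u \<in> ell2 0" for u
    using ell2_nth_le[OF op_boundD(2)[OF A that] i] op_boundD(3)[OF A that] by simp
  have add: "mat_app A (\<lambda>j. u j + v j) i = mat_app A u i + mat_app A v i"
    if "u \<in> ell2 0" "v \<in> ell2 0" for u v
    using that by (intro mat_app_add op_boundD(1)[OF A _ i])
  have cmult: "mat_app A (\<lambda>j. c * u j) i = c * mat_app A u i" for c u
    by (simp add: mat_app_cmult)
  have unit: "A i j = mat_app A (unit_seq j) i" if "j \<ge> 1" for j
    using that by (simp add: mat_app_unit_seq)
  note riesz = riesz_ell2[where f = "\<lambda>u. mat_app A u i" and x = "\<lambda>j. A i j", OF K bound add cmult unit]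
  have "(\<lambda>k. A i k) \<in> ell2 0" "ell2_norm 0 (\<lambda>k. A i k) \<le> K"
    using riesz by blast+
  moreover have "(\<lambda>k. A k i) \<in> ell2 0"
    using op_boundD(2)[OF A unit_seq_ell2[OF i]] i by (simp add: mat_app_unit_seq)
  moreover have "ell2_norm 0 (\<lambda>k. A k i) \<le> K"
    using op_boundD(3)[OF A unit_seq_ell2[OF i]] mult_left_mono[OF ell2_norm_unit_seq[OF i] K] i
    by (simp add: mat_app_unit_seq)
  ultimately show "(\<lambda>k. A i k) \<in> ell2 0 \<and> ell2_norm 0 (\<lambda>k. A i k) \<le> K \<and>
     (\<lambda>k. A k i) \<in> ell2 0 \<and> ell2_norm 0 (\<lambda>k. A k i) \<le> K" by blast
qed

text \<open>For \<open>A\<close>, \<open>B\<close> merely bounded, the double series defining \<open>A (B u)\<close> need not converge absolutely.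
  The Riesz lemma, applied to \<open>u \<mapsto> (A (B u))\<^sub>i\<close>, replaces the interchange of summations.\<close>

lemma op_bound_mat_mult:
  assumes A: "op_bound 0 K A" and B: "op_bound 0 L B"
  shows "op_bound 0 (K * L) (mat_mult A B)"
proof -
  have K: "K \<ge> 0" and L: "L \<ge> 0" using A B by (auto simp: op_bound_def)
  let ?T = "\<lambda>u. mat_app A (mat_app B u)"
  have T2: "?T u \<in> ell2 0" and Tn: "ell2_norm 0 (?T u) \<le> (K * L) * ell2_norm 0 u"
    if u: "u \<in> ell2 0" for u
  proof -
    note Bu = op_boundD[OF B u]
    show "?T u \<in> ell2 0" by (rule op_boundD(2)[OF A Bu(2)])
    show "ell2_norm 0 (?T u) \<le> (K * L) * ell2_norm 0 u"
      using op_boundD(3)[OF A Bu(2)] mult_left_mono[OF Bu(3) K] by (simp add: mult.assoc)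
  qed
  have row: "(\<lambda>j. mat_mult A B i j) \<in> ell2 0"
      "u \<in> ell2 0 \<Longrightarrow> ?T u i = (\<Sum>\<^sub>\<infinity>j\<in>{1..}. mat_mult A B i j * u j)"
    if i: "i \<ge> 1" for i u
  proof -
    have bound: "cmod (?T u i) \<le> (K * L) * ell2_norm 0 u" if u: "u \<in> ell2 0" for u
      using ell2_nth_le[OF T2[OF u] i] Tn[OF u] by simp
    have add: "?T (\<lambda>j. u j + v j) i = ?T u i + ?T v i" if u: "u \<in> ell2 0" and v: "v \<in> ell2 0" for u v
    proof -
      have "?T (\<lambda>j. u j + v j) = mat_app A (\<lambda>k. mat_app B u k + mat_app B v k)"
        using op_boundD(1)[OF B u] op_boundD(1)[OF B v] by (intro mat_app_cong mat_app_add) auto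
      then show ?thesis
        using mat_app_add op_boundD(1)[OF A op_boundD(2)[OF B u] i] op_boundD(1)[OF A op_boundD(2)[OF B v] i]
        by simp
    qed
    have cmult: "?T (\<lambda>j. c * u j) i = c * ?T u i" for c u
      by (simp add: mat_app_cmult)
    \<comment> \<open>Column \<open>j\<close> of the product is \<open>A\<close> applied to column
      \<open>j\<close> of \<open>B\<close>; hence the Riesz coefficients of the functional are the
      entries of \<open>mat_mult A B\<close>.\<close>
    have unit: "mat_mult A B i j = ?T (unit_seq j) i" if "j \<ge> 1" for j
      using that by (simp add: mat_app_unit_seq) (simp add: mat_mult_def mat_app_def)
    note riesz = riesz_ell2[where f = "\<lambda>u. ?T u i" and x = "\<lambda>j. mat_mult A B i j" and K = "K * L",
        OF mult_nonneg_nonneg[OF K L] bound add cmult unit]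
    show "(\<lambda>j. mat_mult A B i j) \<in> ell2 0"
      "u \<in> ell2 0 \<Longrightarrow> ?T u i = (\<Sum>\<^sub>\<infinity>j\<in>{1..}. mat_mult A B i j * u j)"
      using riesz by blast+
  qed
  show ?thesis
    unfolding op_bound_def
  proof (intro conjI ballI allI impI)
    show "K * L \<ge> 0" using K L by simp
    fix u assume u: "u \<in> ell2 0"
    show "(\<lambda>j. mat_mult A B i j * u j) summable_on {1..}" if "i \<ge> 1" for i
      by (rule ell2_cauchy_schwarz(1)[OF row(1)[OF that] u])
    have eq: "mat_app (mat_mult A B) u i = ?T u i" if "i \<ge> 1" for i
      using row(2)[OF that u] by (simp add: mat_app_def)
    show "mat_app (mat_mult A B) u \<in> ell2 0"
      using ell2_cong(1)[OF eq] T2[OF u] by simp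
    show "ell2_norm 0 (mat_app (mat_mult A B) u) \<le> K * L * ell2_norm 0 u"
      using ell2_cong(2)[OF eq] Tn[OF u] by simp
  qed
qed

lemma rc_bound_summable:
  assumes "rc_bound a A" "rc_bound b B" "i \<ge> 1" "j \<ge> 1"
  shows "(\<lambda>k. A i k * B k j) summable_on {1..}"
  using assms by (intro ell2_cauchy_schwarz(1)) (auto simp: rc_bound_def)

lemma rc_bound_entry:
  assumes "rc_bound a A" "i \<ge> 1" "j \<ge> 1"
  shows "cmod (A i j) \<le> a"
  using assms ell2_nth_le[of "\<lambda>k. A i k" j] unfolding rc_bound_def by fastforce

lemma rc_bound_nonneg: "rc_bound a A \<Longrightarrow> a \<ge> 0"
  using rc_bound_entry[of a A 1 1] norm_ge_zero[of "A 1 1"] by linarith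

lemma rc_bound_L2:
  assumes "rc_bound a A" "i \<ge> 1" "finite F" "F \<subseteq> {1..}"
  shows "L2_set (\<lambda>k. cmod (A i k)) F \<le> a" and "L2_set (\<lambda>k. cmod (A k i)) F \<le> a"
  using assms ell2_0_L2_le[of "\<lambda>k. A i k" F] ell2_0_L2_le[of "\<lambda>k. A k i" F]
  unfolding rc_bound_def by fastforce+

section \<open>The difference matrix of a product\<close>

lemma infsum_shift:
  fixes f :: "nat \<Rightarrow> complex"
  assumes "f summable_on {1..}"
  shows "(\<lambda>k. f (k + 1)) summable_on {1..}"
    and "infsum f {1..} = f 1 + (\<Sum>\<^sub>\<infinity>k\<in>{1..}. f (k + 1))"
proof -
  have img: "(\<lambda>k. k + 1) ` {1..} = {2::nat..}"
  proof
    show "{2::nat..} \<subseteq> (\<lambda>k. k + 1) ` {1..}"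
    proof
      fix n :: nat assume "n \<in> {2..}"
      then show "n \<in> (\<lambda>k. k + 1) ` {1..}" by (intro image_eqI[of _ _ "n - 1"]) auto
    qed
  qed auto
  have s: "f summable_on {2..}"
    by (rule summable_on_subset_banach[OF assms]) auto
  show "(\<lambda>k. f (k + 1)) summable_on {1..}"
    using s summable_on_reindex[of "\<lambda>k::nat. k + 1" "{1..}" f] unfolding img by (simp add: o_def)
  have "{1::nat..} = insert 1 {2..}" by auto
  then have "infsum f {1..} = f 1 + infsum f {2..}"
    using infsum_insert[OF s, of 1] by simp
  also have "infsum f {2..} = (\<Sum>\<^sub>\<infinity>k\<in>{1..}. f (k + 1))"
    using infsum_reindex[of "\<lambda>k::nat. k + 1" "{1..}" f] unfolding img by (simp add: o_def)
  finally show "infsum f {1..} = f 1 + (\<Sum>\<^sub>\<infinity>k\<in>{1..}. f (k + 1))" .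
qed

text \<open>Shifting the summation index in the entry \<open>(i + 1, j + 1)\<close> leaves the term
  \<open>k = 1\<close> without a partner in the entry \<open>(i, j)\<close>: this is the boundary
  term of the discrete Leibniz rule.\<close>

lemma Delta_mat_mult:
  assumes A: "rc_bound a A" and B: "rc_bound b B" and i: "i \<ge> 1" and j: "j \<ge> 1"
  shows "Delta (mat_mult A B) i j = A (i + 1) 1 * B 1 (j + 1) +
    (\<Sum>\<^sub>\<infinity>k\<in>{1..}. A (i + 1) (k + 1) * Delta B k j + Delta A i k * B k j)"
proof -
  have s1: "(\<lambda>k. A (i + 1) k * B k (j + 1)) summable_on {1..}"
    by (rule rc_bound_summable[OF A B]) auto
  have s2: "(\<lambda>k. A i k * B k j) summable_on {1..}"
    by (rule rc_bound_summable[OF A B i j])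
  have "Delta (mat_mult A B) i j = A (i + 1) 1 * B 1 (j + 1) +
    ((\<Sum>\<^sub>\<infinity>k\<in>{1..}. A (i + 1) (k + 1) * B (k + 1) (j + 1)) - (\<Sum>\<^sub>\<infinity>k\<in>{1..}. A i k * B k j))"
    using infsum_shift(2)[OF s1] by (simp add: Delta_def mat_mult_def)
  also have "(\<Sum>\<^sub>\<infinity>k\<in>{1..}. A (i + 1) (k + 1) * B (k + 1) (j + 1)) - (\<Sum>\<^sub>\<infinity>k\<in>{1..}. A i k * B k j)
     = (\<Sum>\<^sub>\<infinity>k\<in>{1..}. A (i + 1) (k + 1) * B (k + 1) (j + 1) - A i k * B k j)"
    using infsum_add[OF infsum_shift(1)[OF s1] summable_on_uminus[THEN iffD2, OF s2]]
    by (simp add: infsum_uminus)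
  \<comment> \<open>In each summand \<open>A (i + 1) (k + 1) * B k j\<close> is subtracted and
    added.\<close>
  also have "\<dots> = (\<Sum>\<^sub>\<infinity>k\<in>{1..}. A (i + 1) (k + 1) * Delta B k j + Delta A i k * B k j)"
    by (rule infsum_cong) (simp add: Delta_def algebra_simps)
  finally show ?thesis .
qed

section \<open>Square summable weights and the comparison of the factors min(i,j)^\<alpha>\<close>

lemma sum_inverse_squares_le:
  assumes "finite F" "F \<subseteq> {1..}"
  shows "(\<Sum>k\<in>F. (1 / real k)\<^sup>2) \<le> 2"
proof -
  \<comment> \<open>The stronger bound \<open>2 - 1 / real n\<close> carries the induction: the next
    term is at most \<open>1 / real n - 1 / real (Suc n)\<close>.\<close>
  have "(\<Sum>k=1..n. (1 / real k)\<^sup>2) \<le> 2 - 1 / real n" if "n \<ge> 1" for n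
    using that
  proof (induction n rule: nat_induct_at_least)
    case (Suc n)
    have "(1 / real (Suc n))\<^sup>2 \<le> 1 / real n - 1 / real (Suc n)"
    proof -
      have "(1 / real (Suc n))\<^sup>2 = 1 / (real (Suc n) * real (Suc n))"
        by (simp add: power2_eq_square)
      also have "\<dots> \<le> 1 / (real n * real (Suc n))"
        using Suc.hyps by (intro frac_le mult_right_mono) auto
      also have "\<dots> = 1 / real n - 1 / real (Suc n)"
        using Suc.hyps by (simp add: field_simps)
      finally show ?thesis .
    qed
    with Suc show ?case by simp
  qed simp
  note * = this
  obtain n where n: "F \<subseteq> {..n}" using assms(1) finite_nat_iff_bounded_le by blast
  have "(\<Sum>k\<in>F. (1 / real k)\<^sup>2) \<le> (\<Sum>k=1..Suc n. (1 / real k)\<^sup>2)"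
    using assms n by (intro sum_mono2) (auto simp: subset_iff le_Suc_eq)
  also have "\<dots> \<le> 2 - 1 / real (Suc n)" by (rule *) simp
  also have "\<dots> \<le> 2" by simp
  finally show ?thesis .
qed

lemma L2_set_inverse_le:
  assumes "finite F" "F \<subseteq> {1..}"
  shows "L2_set (\<lambda>k. 1 / real k) F \<le> 2"
  unfolding L2_set_def
  by (rule real_le_lsqrt) (use sum_inverse_squares_le[OF assms] in \<open>auto simp: sum_nonneg\<close>)

text \<open>On each side of \<open>i\<close> the map taking \<open>k\<close> to
  \<open>1 + |i - k|\<close> is injective with positive values, so each half is at most 2 by
  \<open>sum_inverse_squares_le\<close>; the total 4 has root 2.\<close>

lemma L2_set_inverse_dist_le:
  assumes "finite F"
  shows "L2_set (\<lambda>k. 1 / (1 + \<bar>real i - real k\<bar>)) F \<le> 2"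
proof -
  let ?e = "\<lambda>k. (1 / (1 + \<bar>real i - real k\<bar>))\<^sup>2"
  have "(\<Sum>k\<in>{k\<in>F. k \<ge> i}. ?e k) = (\<Sum>m\<in>(\<lambda>k. k - i + 1) ` {k\<in>F. k \<ge> i}. (1 / real m)\<^sup>2)"
    by (subst sum.reindex) (auto simp: inj_on_def of_nat_diff intro!: sum.cong)
  also have "\<dots> \<le> 2" using assms by (intro sum_inverse_squares_le) auto
  finally have up: "(\<Sum>k\<in>{k\<in>F. k \<ge> i}. ?e k) \<le> 2" .
  have "(\<Sum>k\<in>{k\<in>F. \<not> k \<ge> i}. ?e k) = (\<Sum>m\<in>(\<lambda>k. i - k + 1) ` {k\<in>F. \<not> k \<ge> i}. (1 / real m)\<^sup>2)"
    by (subst sum.reindex) (auto simp: inj_on_def of_nat_diff intro!: sum.cong)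
  also have "\<dots> \<le> 2" using assms by (intro sum_inverse_squares_le) auto
  finally have down: "(\<Sum>k\<in>{k\<in>F. \<not> k \<ge> i}. ?e k) \<le> 2" .
  have "F = {k\<in>F. k \<ge> i} \<union> {k\<in>F. \<not> k \<ge> i}" by auto
  then have "(\<Sum>k\<in>F. ?e k) = (\<Sum>k\<in>{k\<in>F. k \<ge> i}. ?e k) + (\<Sum>k\<in>{k\<in>F. \<not> k \<ge> i}. ?e k)"
    using assms by (subst sum.union_disjoint[symmetric]) auto
  with up down show ?thesis
    unfolding L2_set_def by (intro real_le_lsqrt) (auto simp: sum_nonneg)
qed

text \<open>If \<open>k \<le> j\<close>, then \<open>(1 + |i - k| / k) * k = k + |i - k|\<close> is
  at least \<open>i\<close>; otherwise the minimum on the right is \<open>j\<close>. Raising the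
  factor, which is at least 1, to the power \<alpha> \<le> 1 does not increase it. The purpose is to
  trade the row index \<open>i\<close> in the weight for the summation index
  \<open>k\<close>.\<close>

lemma min_powr_ratio:
  assumes "0 \<le> \<alpha>" "\<alpha> \<le> 1" "k \<ge> 1"
  shows "real (min i j) powr \<alpha> \<le> (1 + \<bar>real i - real k\<bar> / real k) * real (min k j) powr \<alpha>"
proof -
  let ?t = "\<bar>real i - real k\<bar> / real k"
  have "real (min i j) \<le> (1 + ?t) * real (min k j)"
  proof (cases "k \<le> j")
    case True
    have "(1 + ?t) * real k = real k + \<bar>real i - real k\<bar>"
      using assms(3) by (simp add: field_simps)
    moreover have "real (min i j) \<le> real i" by simp
    ultimately show ?thesis using True by (simp add: min_absorb1)
  next
    case False
    have "1 * real j \<le> (1 + ?t) * real j"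
      by (intro mult_right_mono) auto
    moreover have "real (min i j) \<le> real j" by simp
    ultimately show ?thesis using False by (simp add: min_absorb2)
  qed
  then have "real (min i j) powr \<alpha> \<le> ((1 + ?t) * real (min k j)) powr \<alpha>"
    using assms by (intro powr_mono2) auto
  also have "\<dots> = (1 + ?t) powr \<alpha> * real (min k j) powr \<alpha>"
    by (rule powr_mult)
  also have "\<dots> \<le> (1 + ?t) powr 1 * real (min k j) powr \<alpha>"
    using assms by (intro mult_right_mono powr_mono) auto
  finally show ?thesis by simp
qed

text \<open>The constant is 1 + 6 + 6, for the boundary term and the two halves of the series in
  \<open>Delta_mat_mult\<close>. Each 6 is 2 * 2 + 1 * 2, where the second factors bound the norms
  of the two square summable weights.\<close>

lemma Delta_mat_mult_bound:
  assumes \<alpha>: "0 \<le> \<alpha>" "\<alpha> \<le> 1"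
    and A: "rc_bound a A" and NA: "rc_bound a (comm_N A)"
    and DA: "\<And>i j. i \<ge> 1 \<Longrightarrow> j \<ge> 1 \<Longrightarrow> real (min i j) powr \<alpha> * cmod (Delta A i j) \<le> a"
    and NDA: "\<And>i j. i \<ge> 1 \<Longrightarrow> j \<ge> 1 \<Longrightarrow> real (min i j) powr \<alpha> * cmod (comm_N (Delta A) i j) \<le> a"
    and B: "rc_bound b B"
    and DB: "\<And>i j. i \<ge> 1 \<Longrightarrow> j \<ge> 1 \<Longrightarrow> real (min i j) powr \<alpha> * cmod (Delta B i j) \<le> b"
    and i: "i \<ge> 1" and j: "j \<ge> 1"
  shows "real (min i j) powr \<alpha> * cmod (Delta (mat_mult A B) i j) \<le> 13 * a * b"
proof -
  have a: "a \<ge> 0" and b: "b \<ge> 0" using rc_bound_nonneg A B by auto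
  let ?m = "real (min i j) powr \<alpha>"
  let ?d = "\<lambda>k. \<bar>real i - real k\<bar>"
  let ?e = "\<lambda>k. 1 / (1 + ?d k)"
  have nN: "cmod (comm_N X p k) = \<bar>real p - real k\<bar> * cmod (X p k)" for X p k
  proof -
    have "(of_nat p - of_nat k :: complex) = of_real (real p - real k)" by simp
    then show ?thesis by (simp only: comm_N_def norm_mult norm_of_real)
  qed
  \<comment> \<open>The freedom in \<open>j'\<close> serves both halves: \<open>j' = j\<close>
    produces the weight belonging to \<open>Delta B k j\<close>, and \<open>j' = i\<close> the one
    belonging to \<open>Delta A i k\<close>.\<close>
  have ratio: "?m \<le> (1 + ?d k / real k) * real (min k j') powr \<alpha>" if "k \<ge> 1" "j' \<ge> min i j" for k j'
  proof -
    have "?m \<le> real (min i j') powr \<alpha>"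
      using that \<alpha> by (intro powr_mono2) auto
    with min_powr_ratio[OF \<alpha> that(1), of i j'] show ?thesis by linarith
  qed
  \<comment> \<open>The weight is at most \<open>i\<close>, which is exactly the commutator factor
    \<open>(i + 1) - 1\<close> of the entry of \<open>A\<close> in column 1.\<close>
  have first: "?m * cmod (A (i + 1) 1 * B 1 (j + 1)) \<le> a * b"
  proof -
    have "?m \<le> real i powr 1"
      using \<alpha> i by (intro order.trans[OF powr_mono2[of \<alpha> _ "real i"] powr_mono]) auto
    then have "?m * cmod (A (i + 1) 1) \<le> real i * cmod (A (i + 1) 1)"
      by (intro mult_right_mono) auto
    also have "\<dots> = cmod (comm_N A (i + 1) 1)"
      by (simp add: nN)
    also have "\<dots> \<le> a" by (rule rc_bound_entry[OF NA]) auto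
    finally have "?m * cmod (A (i + 1) 1) * cmod (B 1 (j + 1)) \<le> a * b"
      using a rc_bound_entry[OF B, of 1 "j + 1"] by (intro mult_mono) auto
    then show ?thesis by (simp add: norm_mult mult.assoc)
  qed
  \<comment> \<open>The weight goes to \<open>Delta B\<close>. Since
    \<open>(i + 1) - (k + 1) = i - k\<close>, the factor \<open>?d k\<close> is absorbed by row
    \<open>i + 1\<close> of the commutator.\<close>
  have second: "(\<Sum>k\<in>F. ?m * cmod (A (i + 1) (k + 1) * Delta B k j)) \<le> 6 * a * b"
    if F: "finite F" "F \<subseteq> {1..}" for F
  proof -
    let ?a = "\<lambda>k. cmod (A (i + 1) (k + 1))"
    have shift: "L2_set (\<lambda>k. f (k + 1)) F = L2_set f (Suc ` F)" for f :: "nat \<Rightarrow> real"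
      unfolding L2_set_def by (subst sum.reindex) auto
    have L0: "L2_set ?a F \<le> a"
      using rc_bound_L2(1)[OF A, of "i + 1" "Suc ` F"] F unfolding shift[of "\<lambda>k. cmod (A (i + 1) k)"] by auto
    have "L2_set (\<lambda>k. ?d k * ?a k) F = L2_set (\<lambda>k. cmod (comm_N A (i + 1) (k + 1))) F"
      by (simp add: nN)
    also have "\<dots> \<le> a"
      using rc_bound_L2(1)[OF NA, of "i + 1" "Suc ` F"] F
      unfolding shift[of "\<lambda>k. cmod (comm_N A (i + 1) k)"] by auto
    finally have L1: "L2_set (\<lambda>k. ?d k * ?a k) F \<le> a" .
    have L2: "L2_set (\<lambda>k. ?a k + ?d k * ?a k) F \<le> 2 * a"
      using L2_set_triangle_ineq[of ?a "\<lambda>k. ?d k * ?a k" F] L0 L1 by linarith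
    have "?m * cmod (A (i + 1) (k + 1) * Delta B k j)
        \<le> (\<bar>?a k + ?d k * ?a k\<bar> * \<bar>?e k\<bar> + \<bar>?d k * ?a k\<bar> * \<bar>1 / real k\<bar>) * b" if k: "k \<in> F" for k
    proof -
      have k1: "k \<ge> 1" using k F by auto
      have "?m * cmod (Delta B k j) \<le> ((1 + ?d k / real k) * real (min k j) powr \<alpha>) * cmod (Delta B k j)"
        by (intro mult_right_mono ratio k1) auto
      also have "\<dots> = (1 + ?d k / real k) * (real (min k j) powr \<alpha> * cmod (Delta B k j))" by simp
      also have "\<dots> \<le> (1 + ?d k / real k) * b"
        by (intro mult_left_mono DB k1 j) auto
      finally have "?a k * (?m * cmod (Delta B k j)) \<le> ?a k * ((1 + ?d k / real k) * b)"
        by (rule mult_left_mono) auto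
      \<comment> \<open>The summand 1 of \<open>1 + ?d k / real k\<close> offers no decay in
        \<open>k\<close>. The decay is gained by writing \<open>?a k\<close> as
        \<open>(1 + ?d k) * ?a k\<close>, still square summable, times the weight
        \<open>?e k\<close>.\<close>
      moreover have "(?a k + ?d k * ?a k) * ?e k = ?a k"
      proof -
        have "1 + ?d k \<noteq> 0" using abs_ge_zero[of "real i - real k"] by linarith
        moreover have "?a k + ?d k * ?a k = ?a k * (1 + ?d k)" by (simp add: algebra_simps)
        ultimately show ?thesis by simp
      qed
      ultimately show ?thesis
        by (simp add: norm_mult algebra_simps)
    qed
    then have "(\<Sum>k\<in>F. ?m * cmod (A (i + 1) (k + 1) * Delta B k j))
        \<le> (\<Sum>k\<in>F. (\<bar>?a k + ?d k * ?a k\<bar> * \<bar>?e k\<bar> + \<bar>?d k * ?a k\<bar> * \<bar>1 / real k\<bar>) * b)"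
      by (intro sum_mono)
    also have "\<dots> = ((\<Sum>k\<in>F. \<bar>?a k + ?d k * ?a k\<bar> * \<bar>?e k\<bar>) + (\<Sum>k\<in>F. \<bar>?d k * ?a k\<bar> * \<bar>1 / real k\<bar>)) * b"
      by (simp only: sum_distrib_right[symmetric] sum.distrib)
    also have "\<dots> \<le> ((2 * a) * 2 + a * 2) * b"
    proof (intro mult_right_mono add_mono b)
      show "(\<Sum>k\<in>F. \<bar>?a k + ?d k * ?a k\<bar> * \<bar>?e k\<bar>) \<le> (2 * a) * 2"
        using a L2 L2_set_inverse_dist_le[OF F(1)]
        by (intro order.trans[OF L2_set_mult_ineq] mult_mono) (auto simp: L2_set_nonneg)
      show "(\<Sum>k\<in>F. \<bar>?d k * ?a k\<bar> * \<bar>1 / real k\<bar>) \<le> a * 2"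
        using a L1 L2_set_inverse_le[OF F]
        by (intro order.trans[OF L2_set_mult_ineq] mult_mono) (auto simp: L2_set_nonneg)
    qed
    finally show ?thesis by simp
  qed
  \<comment> \<open>Now the weight goes to \<open>Delta A\<close>, and \<open>B\<close> enters only
    through the norm of its column \<open>j\<close>.\<close>
  have third: "(\<Sum>k\<in>F. ?m * cmod (Delta A i k * B k j)) \<le> 6 * a * b"
    if F: "finite F" "F \<subseteq> {1..}" for F
  proof -
    let ?c = "\<lambda>k. ?m * cmod (Delta A i k)"
    have c: "?c k \<le> 2 * a * ?e k + a * (1 / real k)" if k: "k \<in> F" for k
    proof -
      have k1: "k \<ge> 1" using k F by auto
      let ?x = "real (min i k) powr \<alpha> * cmod (Delta A i k)"
      have "?c k \<le> ((1 + ?d k / real k) * real (min k i) powr \<alpha>) * cmod (Delta A i k)"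
        by (intro mult_right_mono ratio k1) auto
      also have "\<dots> = ?x + (?d k * ?x) * (1 / real k)"
        by (simp add: algebra_simps min.commute)
      finally have 1: "?c k \<le> ?x + (?d k * ?x) * (1 / real k)" .
      have dx: "?d k * ?x \<le> a"
        using NDA[OF i k1] by (simp add: nN algebra_simps)
      \<comment> \<open>The bounds on \<open>Delta A\<close> and on its commutator add up to decay
        like \<open>?e k\<close>.\<close>
      have "?x * (1 + ?d k) \<le> 2 * a"
        using DA[OF i k1] dx by (simp add: algebra_simps)
      then have "?x \<le> 2 * a * ?e k"
        by (simp add: pos_le_divide_eq add_pos_nonneg)
      moreover have "(?d k * ?x) * (1 / real k) \<le> a * (1 / real k)"
        by (intro mult_right_mono dx) auto
      ultimately show ?thesis using 1 by linarith
    qed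
    have "L2_set ?c F \<le> L2_set (\<lambda>k. 2 * a * ?e k + a * (1 / real k)) F"
      by (rule L2_set_mono) (use c in auto)
    also have "\<dots> \<le> L2_set (\<lambda>k. 2 * a * ?e k) F + L2_set (\<lambda>k. a * (1 / real k)) F"
      by (rule L2_set_triangle_ineq)
    also have "\<dots> = 2 * a * L2_set ?e F + a * L2_set (\<lambda>k. 1 / real k) F"
      using a by (simp only: L2_set_right_distrib mult_nonneg_nonneg zero_le_numeral)
    also have "\<dots> \<le> 2 * a * 2 + a * 2"
      using a L2_set_inverse_dist_le[OF F(1)] L2_set_inverse_le[OF F]
      by (intro add_mono mult_left_mono) auto
    finally have Lc: "L2_set ?c F \<le> 6 * a" by simp
    have "(\<Sum>k\<in>F. ?m * cmod (Delta A i k * B k j)) = (\<Sum>k\<in>F. \<bar>?c k\<bar> * \<bar>cmod (B k j)\<bar>)"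
      by (simp add: norm_mult algebra_simps)
    also have "\<dots> \<le> L2_set ?c F * L2_set (\<lambda>k. cmod (B k j)) F"
      by (rule L2_set_mult_ineq)
    also have "\<dots> \<le> 6 * a * b"
      using Lc rc_bound_L2(2)[OF B j F] a by (intro mult_mono) (auto simp: L2_set_nonneg)
    finally show ?thesis .
  qed
  have "cmod (\<Sum>\<^sub>\<infinity>k\<in>{1..}. of_real ?m * (A (i + 1) (k + 1) * Delta B k j + Delta A i k * B k j)) \<le> 12 * a * b"
  proof (rule summable_infsum_bound(2))
    fix F :: "nat set" assume F: "finite F" "F \<subseteq> {1..}"
    have "(\<Sum>k\<in>F. cmod (of_real ?m * (A (i + 1) (k + 1) * Delta B k j + Delta A i k * B k j)))
      \<le> (\<Sum>k\<in>F. ?m * cmod (A (i + 1) (k + 1) * Delta B k j) + ?m * cmod (Delta A i k * B k j))"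
      unfolding distrib_left[symmetric] norm_mult[of "of_real _"]
      by (intro sum_mono) (auto intro!: mult_left_mono norm_triangle_ineq)
    also have "\<dots> \<le> 12 * a * b"
      using second[OF F] third[OF F] by (simp add: sum.distrib)
    finally show "(\<Sum>k\<in>F. cmod (of_real ?m * (A (i + 1) (k + 1) * Delta B k j + Delta A i k * B k j)))
      \<le> 12 * a * b" .
  qed
  then have rest: "?m * cmod (\<Sum>\<^sub>\<infinity>k\<in>{1..}. A (i + 1) (k + 1) * Delta B k j + Delta A i k * B k j) \<le> 12 * a * b"
    by (simp add: infsum_cmult_right' norm_mult)
  have "?m * cmod (Delta (mat_mult A B) i j) \<le> ?m * cmod (A (i + 1) 1 * B 1 (j + 1)) +
     ?m * cmod (\<Sum>\<^sub>\<infinity>k\<in>{1..}. A (i + 1) (k + 1) * Delta B k j + Delta A i k * B k j)"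
    unfolding Delta_mat_mult[OF A B i j] distrib_left[symmetric]
    by (intro mult_left_mono norm_triangle_ineq) auto
  with first rest show ?thesis by simp
qed

section \<open>Transposition and the product BA\<close>

definition mat_transpose :: "cmat \<Rightarrow> cmat" where
  "mat_transpose A = (\<lambda>i j. A j i)"

lemma rc_bound_mat_transpose: "rc_bound a A \<Longrightarrow> rc_bound a (mat_transpose A)"
  by (simp add: rc_bound_def mat_transpose_def)

lemma comm_N_mat_transpose: "comm_N (mat_transpose A) = (\<lambda>i j. - mat_transpose (comm_N A) i j)"
  by (auto simp: comm_N_def mat_transpose_def algebra_simps fun_eq_iff)

lemma rc_bound_uminus: "rc_bound a A \<Longrightarrow> rc_bound a (\<lambda>i j. - A i j)"
  by (simp add: rc_bound_def ell2_def ell2_norm_def)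

text \<open>Transposition reverses products, commutes with \<open>Delta\<close> and turns the
  commutator into minus its transpose, so \<open>Delta_mat_mult_bound\<close> at the entry
  \<open>(j, i)\<close> of the transposes gives the claim.\<close>

lemma Delta_mat_mult_bound_right:
  assumes \<alpha>: "0 \<le> \<alpha>" "\<alpha> \<le> 1"
    and A: "rc_bound a A" and NA: "rc_bound a (comm_N A)"
    and DA: "\<And>i j. i \<ge> 1 \<Longrightarrow> j \<ge> 1 \<Longrightarrow> real (min i j) powr \<alpha> * cmod (Delta A i j) \<le> a"
    and NDA: "\<And>i j. i \<ge> 1 \<Longrightarrow> j \<ge> 1 \<Longrightarrow> real (min i j) powr \<alpha> * cmod (comm_N (Delta A) i j) \<le> a"
    and B: "rc_bound b B"
    and DB: "\<And>i j. i \<ge> 1 \<Longrightarrow> j \<ge> 1 \<Longrightarrow> real (min i j) powr \<alpha> * cmod (Delta B i j) \<le> b"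
    and i: "i \<ge> 1" and j: "j \<ge> 1"
  shows "real (min i j) powr \<alpha> * cmod (Delta (mat_mult B A) i j) \<le> 13 * a * b"
proof -
  have D: "Delta (mat_transpose X) = mat_transpose (Delta X)" for X
    by (simp add: Delta_def mat_transpose_def)
  have m: "mat_mult (mat_transpose A) (mat_transpose B) = mat_transpose (mat_mult B A)"
    by (simp add: mat_mult_def mat_transpose_def mult.commute)
  have "real (min j i) powr \<alpha> * cmod (Delta (mat_mult (mat_transpose A) (mat_transpose B)) j i) \<le> 13 * a * b"
  proof (rule Delta_mat_mult_bound[OF \<alpha> _ _ _ _ _ _ j i])
    show "rc_bound a (comm_N (mat_transpose A))"
      unfolding comm_N_mat_transpose by (intro rc_bound_uminus rc_bound_mat_transpose NA)
    show "real (min i j) powr \<alpha> * cmod (comm_N (Delta (mat_transpose A)) i j) \<le> a" if "i \<ge> 1" "j \<ge> 1" for i j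
      unfolding D comm_N_mat_transpose using NDA[OF that(2,1)] by (simp add: mat_transpose_def min.commute)
    show "real (min i j) powr \<alpha> * cmod (Delta (mat_transpose A) i j) \<le> a" if "i \<ge> 1" "j \<ge> 1" for i j
      unfolding D using DA[OF that(2,1)] by (simp add: mat_transpose_def min.commute)
    show "real (min i j) powr \<alpha> * cmod (Delta (mat_transpose B) i j) \<le> b" if "i \<ge> 1" "j \<ge> 1" for i j
      unfolding D using DB[OF that(2,1)] by (simp add: mat_transpose_def min.commute)
  qed (intro rc_bound_mat_transpose A B)+
  then show ?thesis
    by (simp add: m D min.commute) (simp add: mat_transpose_def)
qed

section \<open>Quadratic interpolation\<close>

text \<open>At \<open>x = real i powr t\<close> this is the K-functional of the \<open>i\<close>-th
  coordinate with the interpolation weight in \<mu>. The indicator makes it a function on the whole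
  line, to be integrated against \<open>lborel\<close>; it vanishes at \<open>x = 0\<close>, so the
  index 0 contributes nothing.\<close>

definition K_kernel :: "real \<Rightarrow> real \<Rightarrow> real \<Rightarrow> real" where
  "K_kernel \<theta> x \<mu> = indicator {0<..} \<mu> * (\<mu> powr (-\<theta>-1) * (\<mu> * x / (1 + \<mu> * x)))"

lemma K_kernel_nonneg: "x \<ge> 0 \<Longrightarrow> K_kernel \<theta> x \<mu> \<ge> 0"
  by (auto simp: K_kernel_def indicator_def)

lemma K_kernel_measurable [measurable]: "K_kernel \<theta> x \<in> borel_measurable borel"
  unfolding K_kernel_def by measurable

text \<open>Replacing \<mu> by \<mu>/x contributes \<open>x powr (\<theta> + 1)\<close> from the
  power of \<mu> and 1/x from the change of variable.\<close>

lemma nn_integral_K_kernel_scale: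
  assumes x: "x > 0"
  shows "(\<integral>\<^sup>+\<mu>. K_kernel \<theta> x \<mu> \<partial>lborel) = ennreal (x powr \<theta>) * (\<integral>\<^sup>+\<mu>. K_kernel \<theta> 1 \<mu> \<partial>lborel)"
proof -
  have eq: "K_kernel \<theta> x (0 + (1/x) * \<mu>) = x powr (\<theta> + 1) * K_kernel \<theta> 1 \<mu>" for \<mu>
  proof (cases "\<mu> > 0")
    case True
    have "(1/x * \<mu>) powr (-\<theta>-1) = x powr (\<theta> + 1) * \<mu> powr (-\<theta>-1)"
    proof -
      have "(1/x * \<mu>) powr (-\<theta>-1) = (\<mu> / x) powr (-\<theta>-1)" by simp
      also have "\<dots> = \<mu> powr (-\<theta>-1) / x powr (-\<theta>-1)"
        using x True by (intro powr_divide)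
      also have "\<dots> = x powr (-(-\<theta>-1)) * \<mu> powr (-\<theta>-1)"
        unfolding powr_minus_divide by simp
      finally show ?thesis by (simp add: add.commute)
    qed
    with x True show ?thesis by (simp add: K_kernel_def)
  next
    case False
    then have "\<not> \<mu> / x > 0" using x by (simp add: zero_less_divide_iff)
    with False show ?thesis by (simp add: K_kernel_def)
  qed
  have "(\<integral>\<^sup>+\<mu>. K_kernel \<theta> x \<mu> \<partial>lborel) = \<bar>1/x\<bar> * (\<integral>\<^sup>+\<mu>. K_kernel \<theta> x (0 + (1/x) * \<mu>) \<partial>lborel)"
    using x by (intro nn_integral_real_affine) auto
  also have "\<dots> = \<bar>1/x\<bar> * (ennreal (x powr (\<theta> + 1)) * (\<integral>\<^sup>+\<mu>. K_kernel \<theta> 1 \<mu> \<partial>lborel))"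
    unfolding eq by (simp add: ennreal_mult K_kernel_nonneg nn_integral_cmult)
  also have "\<dots> = ennreal (\<bar>1/x\<bar> * x powr (\<theta> + 1)) * (\<integral>\<^sup>+\<mu>. K_kernel \<theta> 1 \<mu> \<partial>lborel)"
    by (simp only: ennreal_mult abs_ge_zero powr_ge_zero mult.assoc)
  also have "\<bar>1/x\<bar> * x powr (\<theta> + 1) = x powr \<theta>"
    using x by (simp add: powr_add)
  finally show ?thesis .
qed

text \<open>Up to 1 the kernel is at most \<open>\<mu> powr (-\<theta>)\<close>, integrable since
  \<theta> < 1; beyond 1 it is at most \<open>\<mu> powr (-\<theta>-1)\<close>, integrable since
  \<theta> > 0.\<close>

lemma nn_integral_K_kernel_finite:
  assumes "0 < \<theta>" "\<theta> < 1"
  shows "(\<integral>\<^sup>+\<mu>. K_kernel \<theta> 1 \<mu> \<partial>lborel) < \<infinity>"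
proof -
  have *: "K_kernel \<theta> 1 \<mu> \<le> indicator {0..1} \<mu> * \<mu> powr (-\<theta>) + indicator {1..} \<mu> * \<mu> powr (-\<theta>-1)" for \<mu>
  proof (cases "\<mu> > 0")
    case True
    have 1: "\<mu> powr (-\<theta>-1) * (\<mu> / (1 + \<mu>)) \<le> \<mu> powr (-\<theta>-1) * \<mu>"
      using True by (intro mult_left_mono) (auto simp: field_simps)
    have 2: "\<mu> powr (-\<theta>-1) * (\<mu> / (1 + \<mu>)) \<le> \<mu> powr (-\<theta>-1) * 1"
      using True by (intro mult_left_mono) (auto simp: field_simps)
    have "\<mu> powr (-\<theta>-1) * \<mu> = \<mu> powr (-\<theta>)"
      using True powr_add[of \<mu> "-\<theta>-1" 1] by simp
    with True 1 2 show ?thesis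
      by (cases "\<mu> \<le> 1") (auto simp: K_kernel_def indicator_def add_increasing2)
  qed (simp add: K_kernel_def)
  have "(\<integral>\<^sup>+\<mu>. K_kernel \<theta> 1 \<mu> \<partial>lborel) \<le> (\<integral>\<^sup>+\<mu>. ennreal (indicator {0..1} \<mu> * \<mu> powr (-\<theta>)) + ennreal (indicator {1..} \<mu> * \<mu> powr (-\<theta>-1)) \<partial>lborel)"
    by (intro nn_integral_mono) (use * in \<open>auto simp flip: ennreal_plus intro!: ennreal_leI\<close>)
  also have "\<dots> = (\<integral>\<^sup>+\<mu>. ennreal (indicator {0..1} \<mu> * \<mu> powr (-\<theta>)) \<partial>lborel) + (\<integral>\<^sup>+\<mu>. ennreal (indicator {1..} \<mu> * \<mu> powr (-\<theta>-1)) \<partial>lborel)"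
    by (intro nn_integral_add) auto
  also have "(\<integral>\<^sup>+\<mu>. ennreal (indicator {0..1} \<mu> * \<mu> powr (-\<theta>)) \<partial>lborel) = ennreal (1 powr (-\<theta>+1) / (-\<theta>+1))"
    using assms by (intro nn_integral_has_integral_lebesgue has_integral_powr_from_0) auto
  also have "(\<integral>\<^sup>+\<mu>. ennreal (indicator {1..} \<mu> * \<mu> powr (-\<theta>-1)) \<partial>lborel) = ennreal (-(1 powr (-\<theta>-1+1)) / (-\<theta>-1+1))"
    using assms by (intro nn_integral_has_integral_lebesgue has_integral_powr_to_inf) auto
  also have "ennreal (1 powr (-\<theta>+1) / (-\<theta>+1)) + ennreal (-(1 powr (-\<theta>-1+1)) / (-\<theta>-1+1)) < \<infinity>"
    by simp
  finally show ?thesis .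
qed

text \<open>Together with finiteness this allows the integral to be cancelled from both sides of an
  inequality in \<open>ennreal\<close>.\<close>

lemma nn_integral_K_kernel_nonzero: "(\<integral>\<^sup>+\<mu>. K_kernel \<theta> 1 \<mu> \<partial>lborel) \<noteq> 0"
proof
  assume "(\<integral>\<^sup>+\<mu>. K_kernel \<theta> 1 \<mu> \<partial>lborel) = 0"
  then have "AE \<mu> in lborel. ennreal (K_kernel \<theta> 1 \<mu>) = 0"
    by (subst (asm) nn_integral_0_iff_AE) auto
  then have "AE \<mu> in lborel. \<mu> \<notin> {0<..<1::real}"
    by eventually_elim (auto simp: K_kernel_def divide_le_0_iff mult_le_0_iff powr_def ennreal_eq_0_iff)
  then have "emeasure lborel {\<mu>\<in>space lborel. \<not> \<mu> \<notin> {0<..<1::real}} = 0"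
    by (rule AE_iff_measurable[OF _ refl, THEN iffD1, rotated]) auto
  moreover have "{\<mu>\<in>space lborel. \<not> \<mu> \<notin> {0<..<1::real}} = {0<..<1}" by auto
  ultimately show False by simp
qed

text \<open>The series form is the one that \<open>nn_integral_suminf\<close> can exchange with the
  integral; \<open>f 0 = 0\<close> fills the index missing from \<open>{1..}\<close>.\<close>

lemma ennreal_infsum_nat:
  fixes f :: "nat \<Rightarrow> real"
  assumes "f summable_on {1..}" "\<And>i. f i \<ge> 0" "f 0 = 0"
  shows "ennreal (infsum f {1..}) = (\<Sum>i. ennreal (f i))"
proof -
  have "f summable_on UNIV"
    using assms(1) by (rule summable_on_cong_neutral[THEN iffD1, rotated -1]) (use assms(3) in \<open>auto simp: not_le\<close>)
  then have "f sums infsum f UNIV"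
    by (intro has_sum_imp_sums has_sum_infsum)
  moreover have "infsum f UNIV = infsum f {1..}"
    by (rule infsum_cong_neutral) (use assms(3) in \<open>auto simp: not_le\<close>)
  ultimately show ?thesis
    using assms(2) by (metis sums_unique suminf_ennreal2 sums_summable)
qed

text \<open>After multiplication by \<open>1 + x\<close> and the triangle inequality, the gap
  between the two sides is the square of \<open>cmod a - x * cmod b\<close>. It bounds the
  K-functional of one coordinate from below for every splitting, and is applied to the images under
  \<open>A\<close>.\<close>

lemma weighted_split:
  fixes a b :: complex
  assumes "x \<ge> 0"
  shows "x / (1 + x) * (cmod (a + b))\<^sup>2 \<le> (cmod a)\<^sup>2 + x * (cmod b)\<^sup>2"
proof -
  have "(cmod (a + b))\<^sup>2 \<le> (cmod a + cmod b)\<^sup>2"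
    by (intro power_mono norm_triangle_ineq) auto
  then have "x * (cmod (a + b))\<^sup>2 \<le> x * (cmod a + cmod b)\<^sup>2"
    using assms by (rule mult_left_mono)
  also have "\<dots> \<le> x * (cmod a + cmod b)\<^sup>2 + (cmod a - x * cmod b)\<^sup>2"
    by simp
  also have "\<dots> = ((cmod a)\<^sup>2 + x * (cmod b)\<^sup>2) * (1 + x)"
    by (simp add: power2_eq_square algebra_simps)
  finally show ?thesis
    using assms by (simp add: pos_divide_le_eq)
qed

text \<open>The sums over \<open>\<phi>\<close> are the quadratic K-functional of \<open>\<ell>\<^sup>2\<^sub>0\<close> and \<open>\<ell>\<^sup>2\<^sub>t\<close> at \<open>\<mu>\<close>: the infimum of
  \<open>\<parallel>v\<parallel>\<^sup>2 + \<mu> \<parallel>w\<parallel>\<^sup>2\<close> over all splittings \<open>u = v + w\<close> is attained at \<open>v = \<phi> u\<close>.\<close>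

lemma K_kernel_ineq:
  fixes A :: cmat
  assumes A0: "op_bound 0 K A" and At: "op_bound t K A"
    and \<theta>: "0 < \<theta>" "\<theta> < 1" and u: "u \<in> ell2 (\<theta> * t)" and \<mu>: "\<mu> > 0"
  defines "\<phi> \<equiv> \<lambda>i. \<mu> * real i powr t / (1 + \<mu> * real i powr t)"
  shows "(\<lambda>i. \<phi> i * (cmod (u i))\<^sup>2) summable_on {1..}"
    and "\<And>i. i \<ge> 1 \<Longrightarrow> (\<lambda>j. A i j * u j) summable_on {1..}"
    and "\<And>F. finite F \<Longrightarrow> F \<subseteq> {1..} \<Longrightarrow> (\<Sum>i\<in>F. \<phi> i * (cmod (mat_app A u i))\<^sup>2)
        \<le> K\<^sup>2 * (\<Sum>\<^sub>\<infinity>i\<in>{1..}. \<phi> i * (cmod (u i))\<^sup>2)"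
proof -
  define x where "x = (\<lambda>i::nat. \<mu> * real i powr t)"
  have x0: "x i \<ge> 0" for i using \<mu> by (simp add: x_def)
  have \<phi>: "\<phi> i = x i / (1 + x i)" for i by (simp add: \<phi>_def x_def)
  have \<phi>0: "\<phi> i \<ge> 0" and \<phi>1: "\<phi> i \<le> 1" for i using x0[of i] by (auto simp: \<phi>)
  \<comment> \<open>The chain is \<open>\<phi> i \<le> min 1 (x i) \<le> x i powr \<theta>\<close>;
    it makes the K-functional finite on \<open>ell2 (\<theta> * t)\<close>.\<close>
  have \<phi>\<theta>: "\<phi> i \<le> \<mu> powr \<theta> * real i powr (\<theta> * t)" for i
  proof -
    have "\<phi> i \<le> x i powr \<theta>"
    proof (cases "x i \<le> 1")
      case True
      have "\<phi> i \<le> x i powr 1" using x0[of i] by (simp add: \<phi> field_simps)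
      also have "x i powr 1 \<le> x i powr \<theta>"
        using True \<theta> x0[of i] by (intro powr_mono') auto
      finally show ?thesis .
    next
      case False
      then have "1 \<le> x i powr \<theta>" using \<theta> by (intro ge_one_powr_ge_zero) auto
      with \<phi>1[of i] show ?thesis by linarith
    qed
    also have "\<dots> = \<mu> powr \<theta> * real i powr (\<theta> * t)"
      by (simp add: x_def powr_mult powr_powr mult.commute)
    finally show ?thesis .
  qed
  let ?f = "\<lambda>i. \<phi> i * (cmod (u i))\<^sup>2"
  have "(\<lambda>i. \<mu> powr \<theta> * (real i powr (\<theta> * t) * (cmod (u i))\<^sup>2)) summable_on {1..}"
    using u by (intro summable_on_cmult_right) (simp add: ell2_def)
  then show S: "?f summable_on {1..}"
  proof (rule summable_on_comparison_test)
    show "?f i \<le> \<mu> powr \<theta> * (real i powr (\<theta> * t) * (cmod (u i))\<^sup>2)" for i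
      using mult_right_mono[OF \<phi>\<theta>, of "(cmod (u i))\<^sup>2" i] by (simp add: mult.assoc)
  qed (auto simp: \<phi>0)
  define v w where "v = (\<lambda>i. of_real (\<phi> i) * u i)" and "w = (\<lambda>i. of_real (1 / (1 + x i)) * u i)"
  have vw: "u i = v i + w i" for i
  proof -
    have "\<phi> i + 1 / (1 + x i) = 1" using x0[of i] by (simp add: \<phi> field_simps)
    then show ?thesis
      unfolding v_def w_def distrib_right[symmetric] of_real_add[symmetric] by simp
  qed
  \<comment> \<open>The splitting is optimal coordinate by coordinate, by
    \<open>\<phi>^2 + x / (1 + x)^2 = \<phi>\<close> for
    \<open>\<phi> = x / (1 + x)\<close>.\<close>
  have sq: "(cmod (v i))\<^sup>2 + x i * (cmod (w i))\<^sup>2 = ?f i" for i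
  proof -
    have "(\<phi> i)\<^sup>2 + x i * (1 / (1 + x i))\<^sup>2 = \<phi> i"
      using x0[of i] by (simp add: \<phi> divide_simps power2_eq_square) (simp add: algebra_simps)
    then have "((\<phi> i)\<^sup>2 + x i * (1 / (1 + x i))\<^sup>2) * (cmod (u i))\<^sup>2 = ?f i" by simp
    then show ?thesis
      using x0[of i] \<phi>0[of i]
      by (simp add: v_def w_def norm_mult power_mult_distrib algebra_simps norm_divide power_divide
            del: of_real_add of_real_divide)
  qed
  have Sv: "(\<lambda>i. (cmod (v i))\<^sup>2) summable_on {1..}"
    by (rule summable_on_comparison_test[OF S]) (use sq x0 in \<open>auto simp flip: sq\<close>)
  have Sw: "(\<lambda>i. x i * (cmod (w i))\<^sup>2) summable_on {1..}"
    by (rule summable_on_comparison_test[OF S]) (use sq x0 in \<open>auto simp flip: sq\<close>)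
  have "(\<lambda>i. (1 / \<mu>) * (x i * (cmod (w i))\<^sup>2)) summable_on {1..}"
    by (intro summable_on_cmult_right Sw)
  then have w: "w \<in> ell2 t"
    using \<mu> by (simp add: ell2_def x_def mult.assoc)
  have v0: "real i powr 0 * (cmod (v i))\<^sup>2 = (cmod (v i))\<^sup>2" if "i \<in> {1..}" for i
    using that by simp
  have "(\<lambda>i. real i powr 0 * (cmod (v i))\<^sup>2) summable_on {1..} \<longleftrightarrow> (\<lambda>i. (cmod (v i))\<^sup>2) summable_on {1..}"
    by (rule summable_on_cong[OF v0])
  with Sv have v: "v \<in> ell2 0"
    by (simp only: ell2_def mem_Collect_eq)
  have "(ell2_norm 0 v)\<^sup>2 = (\<Sum>\<^sub>\<infinity>i\<in>{1..}. real i powr 0 * (cmod (v i))\<^sup>2)"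
    unfolding ell2_norm_def by (intro real_sqrt_pow2 infsum_nonneg) auto
  also have "\<dots> = (\<Sum>\<^sub>\<infinity>i\<in>{1..}. (cmod (v i))\<^sup>2)"
    by (rule infsum_cong[OF v0])
  finally have nv: "(ell2_norm 0 v)\<^sup>2 = (\<Sum>\<^sub>\<infinity>i\<in>{1..}. (cmod (v i))\<^sup>2)" .
  have "\<mu> * (ell2_norm t w)\<^sup>2 = \<mu> * (\<Sum>\<^sub>\<infinity>i\<in>{1..}. real i powr t * (cmod (w i))\<^sup>2)"
    unfolding ell2_norm_def by (simp add: infsum_nonneg)
  also have "\<dots> = (\<Sum>\<^sub>\<infinity>i\<in>{1..}. x i * (cmod (w i))\<^sup>2)"
    by (simp add: x_def mult.assoc infsum_cmult_right')
  finally have nw: "\<mu> * (ell2_norm t w)\<^sup>2 = (\<Sum>\<^sub>\<infinity>i\<in>{1..}. x i * (cmod (w i))\<^sup>2)" .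
  have nvw: "(ell2_norm 0 v)\<^sup>2 + \<mu> * (ell2_norm t w)\<^sup>2 = infsum ?f {1..}"
    unfolding nv nw using infsum_add[OF Sv Sw] by (simp add: sq)
  have u_eq: "u = (\<lambda>i. v i + w i)" using vw by blast
  note Av = op_boundD[OF A0 v] and Aw = op_boundD[OF At w]
  \<comment> \<open>The sequence \<open>u\<close> may lie in only one of the endpoint spaces; each
    row series is split along \<open>v\<close> and \<open>w\<close>, on which \<open>A\<close> is
    known to act.\<close>
  show "(\<lambda>j. A i j * u j) summable_on {1..}" if "i \<ge> 1" for i
    unfolding u_eq distrib_left by (intro summable_on_add Av(1) Aw(1) that)
  fix F :: "nat set" assume F: "finite F" "F \<subseteq> {1..}"
  have "(\<Sum>i\<in>F. \<phi> i * (cmod (mat_app A u i))\<^sup>2)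
      \<le> (\<Sum>i\<in>F. (cmod (mat_app A v i))\<^sup>2 + \<mu> * (real i powr t * (cmod (mat_app A w i))\<^sup>2))"
  proof (rule sum_mono)
    fix i assume "i \<in> F"
    then have i: "i \<ge> 1" using F by auto
    have "mat_app A u i = mat_app A v i + mat_app A w i"
      unfolding u_eq by (intro mat_app_add Av(1) Aw(1) i)
    then show "\<phi> i * (cmod (mat_app A u i))\<^sup>2
      \<le> (cmod (mat_app A v i))\<^sup>2 + \<mu> * (real i powr t * (cmod (mat_app A w i))\<^sup>2)"
      using weighted_split[OF x0, of i "mat_app A v i" "mat_app A w i"] by (simp add: \<phi>) (simp add: x_def mult.assoc)
  qed
  also have "\<dots> = (\<Sum>i\<in>F. (cmod (mat_app A v i))\<^sup>2) + \<mu> * (\<Sum>i\<in>F. real i powr t * (cmod (mat_app A w i))\<^sup>2)"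
    by (simp add: sum.distrib sum_distrib_left)
  also have "\<dots> \<le> (K * ell2_norm 0 v)\<^sup>2 + \<mu> * (K * ell2_norm t w)\<^sup>2"
  proof (intro add_mono mult_left_mono)
    have "(\<Sum>i\<in>F. (cmod (mat_app A v i))\<^sup>2) = (L2_set (\<lambda>i. cmod (mat_app A v i)) F)\<^sup>2"
      by (simp add: L2_set_def sum_nonneg)
    also have "\<dots> \<le> (K * ell2_norm 0 v)\<^sup>2"
      using ell2_0_L2_le[OF Av(2) F] Av(3) by (intro power_mono) (auto simp: L2_set_nonneg)
    finally show "(\<Sum>i\<in>F. (cmod (mat_app A v i))\<^sup>2) \<le> (K * ell2_norm 0 v)\<^sup>2" .
    have "(\<Sum>i\<in>F. real i powr t * (cmod (mat_app A w i))\<^sup>2) = (L2_set (\<lambda>i. real i powr (t/2) * cmod (mat_app A w i)) F)\<^sup>2"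
      unfolding L2_set_def real_sqrt_pow2[OF sum_nonneg[OF zero_le_power2]]
      by (rule sum.cong) (auto simp: power_mult_distrib power2_eq_square simp flip: powr_add)
    also have "\<dots> \<le> (K * ell2_norm t w)\<^sup>2"
      using ell2_L2_le[OF Aw(2) F] Aw(3) by (intro power_mono) (auto simp: L2_set_nonneg)
    finally show "(\<Sum>i\<in>F. real i powr t * (cmod (mat_app A w i))\<^sup>2) \<le> (K * ell2_norm t w)\<^sup>2" .
  qed (use \<mu> in auto)
  also have "\<dots> = K\<^sup>2 * ((ell2_norm 0 v)\<^sup>2 + \<mu> * (ell2_norm t w)\<^sup>2)"
    by (simp add: power_mult_distrib algebra_simps)
  finally show "(\<Sum>i\<in>F. \<phi> i * (cmod (mat_app A u i))\<^sup>2) \<le> K\<^sup>2 * infsum ?f {1..}"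
    unfolding nvw .
qed

lemma op_bound_interpolate:
  assumes A0: "op_bound 0 K A" and At: "op_bound t K A" and \<theta>: "0 < \<theta>" "\<theta> < 1"
  shows "op_bound (\<theta> * t) K A"
proof -
  have K: "K \<ge> 0" using A0 by (simp add: op_bound_def)
  let ?J = "\<lambda>x. \<integral>\<^sup>+\<mu>. K_kernel \<theta> x \<mu> \<partial>lborel"
  have J: "?J (real i powr t) = ennreal (real i powr (\<theta> * t)) * ?J 1" for i
  proof (cases "i = 0")
    case True
    then show ?thesis by (simp add: K_kernel_def)
  next
    case False
    then show ?thesis
      using nn_integral_K_kernel_scale[of "real i powr t" \<theta>] by (simp add: powr_powr mult.commute)
  qed
  have Jc: "(\<integral>\<^sup>+\<mu>. ennreal (K_kernel \<theta> (real i powr t) \<mu> * c) \<partial>lborel)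
      = ennreal (real i powr (\<theta> * t) * c) * ?J 1" if "c \<ge> 0" for i c
  proof -
    have "(\<integral>\<^sup>+\<mu>. ennreal (K_kernel \<theta> (real i powr t) \<mu> * c) \<partial>lborel) = ?J (real i powr t) * ennreal c"
      using that by (simp add: ennreal_mult K_kernel_nonneg nn_integral_multc)
    then show ?thesis
      using that by (simp only: J) (simp add: ennreal_mult mult_ac)
  qed
  have main: "(\<Sum>i\<in>F. real i powr (\<theta> * t) * (cmod (mat_app A u i))\<^sup>2) \<le> (K * ell2_norm (\<theta> * t) u)\<^sup>2"
    if u: "u \<in> ell2 (\<theta> * t)" and F: "finite F" "F \<subseteq> {1..}" for u F
  proof -
    let ?k = "\<lambda>i. K_kernel \<theta> (real i powr t)"
    \<comment> \<open>The comparison takes place in \<open>ennreal\<close>, where sums and integrals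
      of nonnegative functions may be exchanged without integrability conditions.\<close>
    have pw: "(\<Sum>i\<in>F. ennreal (?k i \<mu> * (cmod (mat_app A u i))\<^sup>2))
        \<le> ennreal (K\<^sup>2) * (\<Sum>i. ennreal (?k i \<mu> * (cmod (u i))\<^sup>2))" for \<mu>
    proof (cases "\<mu> > 0")
      case True
      let ?\<phi> = "\<lambda>i. \<mu> * real i powr t / (1 + \<mu> * real i powr t)"
      have k: "?k i \<mu> * c = \<mu> powr (-\<theta>-1) * (?\<phi> i * c)" for i c
        using True by (simp add: K_kernel_def)
      note ineq = K_kernel_ineq[OF A0 At \<theta> u True]
      have S: "(\<lambda>i. ?k i \<mu> * (cmod (u i))\<^sup>2) summable_on {1..}"
        unfolding k by (intro summable_on_cmult_right ineq(1))
      have "(\<Sum>i\<in>F. ennreal (?k i \<mu> * (cmod (mat_app A u i))\<^sup>2)) = ennreal (\<Sum>i\<in>F. ?k i \<mu> * (cmod (mat_app A u i))\<^sup>2)"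
        by (intro sum_ennreal) (auto simp: K_kernel_nonneg)
      also have "\<dots> \<le> ennreal (K\<^sup>2 * (\<Sum>\<^sub>\<infinity>i\<in>{1..}. ?k i \<mu> * (cmod (u i))\<^sup>2))"
      proof (rule ennreal_leI)
        have "\<mu> powr (-\<theta>-1) * (\<Sum>i\<in>F. ?\<phi> i * (cmod (mat_app A u i))\<^sup>2)
          \<le> \<mu> powr (-\<theta>-1) * (K\<^sup>2 * (\<Sum>\<^sub>\<infinity>i\<in>{1..}. ?\<phi> i * (cmod (u i))\<^sup>2))"
          by (intro mult_left_mono ineq(3) F) auto
        then show "(\<Sum>i\<in>F. ?k i \<mu> * (cmod (mat_app A u i))\<^sup>2) \<le> K\<^sup>2 * (\<Sum>\<^sub>\<infinity>i\<in>{1..}. ?k i \<mu> * (cmod (u i))\<^sup>2)"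
          unfolding k sum_distrib_left[symmetric] infsum_cmult_right' by (simp add: mult_ac)
      qed
      also have "\<dots> = ennreal (K\<^sup>2) * ennreal (\<Sum>\<^sub>\<infinity>i\<in>{1..}. ?k i \<mu> * (cmod (u i))\<^sup>2)"
        by (intro ennreal_mult infsum_nonneg) (auto simp: K_kernel_nonneg)
      also have "ennreal (\<Sum>\<^sub>\<infinity>i\<in>{1..}. ?k i \<mu> * (cmod (u i))\<^sup>2) = (\<Sum>i. ennreal (?k i \<mu> * (cmod (u i))\<^sup>2))"
        using S by (intro ennreal_infsum_nat) (auto simp: K_kernel_nonneg, simp add: K_kernel_def)
      finally show ?thesis .
    qed (simp add: K_kernel_def)
    have Su: "(\<lambda>i. real i powr (\<theta> * t) * (cmod (u i))\<^sup>2) summable_on {1..}"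
      using u by (simp add: ell2_def)
    have "ennreal (\<Sum>i\<in>F. real i powr (\<theta> * t) * (cmod (mat_app A u i))\<^sup>2) * ?J 1
        = (\<Sum>i\<in>F. ennreal (real i powr (\<theta> * t) * (cmod (mat_app A u i))\<^sup>2) * ?J 1)"
      by (simp add: sum_distrib_right flip: sum_ennreal)
    also have "\<dots> = (\<integral>\<^sup>+\<mu>. (\<Sum>i\<in>F. ennreal (?k i \<mu> * (cmod (mat_app A u i))\<^sup>2)) \<partial>lborel)"
      by (subst nn_integral_sum) (auto simp: Jc)
    also have "\<dots> \<le> (\<integral>\<^sup>+\<mu>. ennreal (K\<^sup>2) * (\<Sum>i. ennreal (?k i \<mu> * (cmod (u i))\<^sup>2)) \<partial>lborel)"
      by (intro nn_integral_mono pw)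
    also have "\<dots> = ennreal (K\<^sup>2) * (\<Sum>i. ennreal (real i powr (\<theta> * t) * (cmod (u i))\<^sup>2) * ?J 1)"
      by (subst nn_integral_cmult, simp, subst nn_integral_suminf) (auto simp: Jc)
    also have "\<dots> = ennreal (K\<^sup>2) * (\<Sum>i. ennreal (real i powr (\<theta> * t) * (cmod (u i))\<^sup>2)) * ?J 1"
      by (simp add: mult.assoc)
    also have "(\<Sum>i. ennreal (real i powr (\<theta> * t) * (cmod (u i))\<^sup>2))
        = ennreal (\<Sum>\<^sub>\<infinity>i\<in>{1..}. real i powr (\<theta> * t) * (cmod (u i))\<^sup>2)"
      using Su by (intro ennreal_infsum_nat[symmetric]) auto
    also have "(\<Sum>\<^sub>\<infinity>i\<in>{1..}. real i powr (\<theta> * t) * (cmod (u i))\<^sup>2) = (ell2_norm (\<theta> * t) u)\<^sup>2"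
      by (simp add: ell2_norm_def infsum_nonneg)
    also have "ennreal (K\<^sup>2) * ennreal ((ell2_norm (\<theta> * t) u)\<^sup>2) = ennreal ((K * ell2_norm (\<theta> * t) u)\<^sup>2)"
      by (simp add: power_mult_distrib ennreal_mult)
    finally have "ennreal (\<Sum>i\<in>F. real i powr (\<theta> * t) * (cmod (mat_app A u i))\<^sup>2)
        \<le> ennreal ((K * ell2_norm (\<theta> * t) u)\<^sup>2)"
      using nn_integral_K_kernel_finite[OF \<theta>] nn_integral_K_kernel_nonzero[of \<theta>]
      by (simp add: mult.commute[of _ "?J 1"] ennreal_mult_le_mult_iff)
    then show ?thesis by (simp add: ennreal_le_iff)
  qed
  show ?thesis
    unfolding op_bound_def
  proof (intro conjI ballI allI impI)
    fix u assume u: "u \<in> ell2 (\<theta> * t)"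
    \<comment> \<open>Any positive \<mu> gives a splitting that proves convergence; 1 is
      chosen.\<close>
    show "(\<lambda>j. A i j * u j) summable_on {1..}" if "i \<ge> 1" for i
      by (rule K_kernel_ineq(2)[OF A0 At \<theta> u zero_less_one that])
    have "L2_set (\<lambda>i. real i powr ((\<theta> * t)/2) * cmod (mat_app A u i)) F \<le> K * ell2_norm (\<theta> * t) u"
      if F: "finite F" "F \<subseteq> {1..}" for F
    proof -
      have "(\<Sum>i\<in>F. (real i powr ((\<theta> * t)/2) * cmod (mat_app A u i))\<^sup>2)
          = (\<Sum>i\<in>F. real i powr (\<theta> * t) * (cmod (mat_app A u i))\<^sup>2)"
        by (rule sum.cong) (auto simp: power_mult_distrib power2_eq_square simp flip: powr_add)
      with main[OF u F] K show ?thesis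
        unfolding L2_set_def by (intro real_le_lsqrt) auto
    qed
    from ell2_bound[OF _ this] K show "mat_app A u \<in> ell2 (\<theta> * t)"
      "ell2_norm (\<theta> * t) (mat_app A u) \<le> K * ell2_norm (\<theta> * t) u" by auto
  qed (rule K)
qed

lemma op_bound_mono:
  assumes "op_bound s K A" "K \<le> L"
  shows "op_bound s L A"
proof -
  have "x \<le> L * ell2_norm s u" if "x \<le> K * ell2_norm s u" for x u
    using that mult_right_mono[OF assms(2), of "ell2_norm s u"] by simp
  then show ?thesis
    using assms by (auto simp: op_bound_def)
qed

section \<open>The commutator with the position operator\<close>

text \<open>This is row \<open>i\<close> of NAu = ANu + [N,A]u. The convergence hypotheses are per
  row to serve both endpoints: for exponent 2, \<open>A\<close> acts on both sequences in
  \<open>ell2 0\<close>; for exponent -2, convergence of the second series is derived from the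
  commutator.\<close>

lemma comm_N_app:
  assumes "(\<lambda>j. A i j * u j) summable_on {1..}" "(\<lambda>j. A i j * (of_nat j * u j)) summable_on {1..}"
  shows "of_nat i * mat_app A u i = mat_app A (\<lambda>j. of_nat j * u j) i + mat_app (comm_N A) u i"
    and "(\<lambda>j. comm_N A i j * u j) summable_on {1..}"
proof -
  have eq: "comm_N A i j * u j = of_nat i * (A i j * u j) + - (A i j * (of_nat j * u j))" for j
    by (simp add: comm_N_def algebra_simps)
  note s = summable_on_cmult_right[OF assms(1), of "of_nat i"] summable_on_uminus[THEN iffD2, OF assms(2)]
  show "(\<lambda>j. comm_N A i j * u j) summable_on {1..}"
    unfolding eq by (intro summable_on_add s)
  show "of_nat i * mat_app A u i = mat_app A (\<lambda>j. of_nat j * u j) i + mat_app (comm_N A) u i"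
    unfolding mat_app_def eq infsum_add[OF s] by (simp add: infsum_cmult_right' infsum_uminus)
qed

lemma M_plus_op_bound_2:
  assumes A: "op_bound 0 K A" and NA: "op_bound 0 L (comm_N A)"
  shows "op_bound 2 (K + L) A"
  unfolding op_bound_def
proof (intro conjI ballI allI impI)
  have K: "K \<ge> 0" and L: "L \<ge> 0" using A NA by (auto simp: op_bound_def)
  then show "K + L \<ge> 0" by simp
  fix u assume u: "u \<in> ell2 2"
  have u0: "u \<in> ell2 0" and nu: "ell2_norm 0 u \<le> ell2_norm 2 u"
    using ell2_subset[OF u, of 0] by auto
  let ?v = "\<lambda>j. of_nat j * u j"
  have v: "?v \<in> ell2 0" and nv: "ell2_norm 0 ?v \<le> ell2_norm 2 u"
    using ell2_mono[OF u, of 0 ?v] by (auto simp: norm_mult)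
  note Au = op_boundD[OF A u0] and Av = op_boundD[OF A v] and NAu = op_boundD[OF NA u0]
  show "(\<lambda>j. A i j * u j) summable_on {1..}" if "i \<ge> 1" for i by (rule Au(1)[OF that])
  have s: "(\<lambda>i. mat_app A ?v i + mat_app (comm_N A) u i) \<in> ell2 0"
    and n: "ell2_norm 0 (\<lambda>i. mat_app A ?v i + mat_app (comm_N A) u i) \<le> (K + L) * ell2_norm 2 u"
    using ell2_add[OF Av(2) NAu(2)] Av(3) NAu(3) mult_left_mono[OF nv K] mult_left_mono[OF nu L]
    by (auto simp: distrib_right)
  have le: "real i powr (2/2) * cmod (mat_app A u i)
      \<le> real i powr (0/2) * cmod (mat_app A ?v i + mat_app (comm_N A) u i)" if "i \<ge> 1" for i
    unfolding comm_N_app(1)[of A i u, OF Au(1)[OF that] Av(1)[OF that], symmetric] using that by (simp add: norm_mult)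
  show "mat_app A u \<in> ell2 2" "ell2_norm 2 (mat_app A u) \<le> (K + L) * ell2_norm 2 u"
    using ell2_mono[OF s le] n by auto
qed

lemma M_plus_op_bound_minus_2:
  assumes A: "op_bound 0 K A" and NA: "op_bound 0 L (comm_N A)"
  shows "op_bound (-2) (K + L) A"
  unfolding op_bound_def
proof (intro conjI ballI allI impI)
  have K: "K \<ge> 0" and L: "L \<ge> 0" using A NA by (auto simp: op_bound_def)
  then show "K + L \<ge> 0" by simp
  fix u assume u: "u \<in> ell2 (-2)"
  define v where "v = (\<lambda>j. u j / of_nat j)"
  have "real i powr (0/2) * cmod (v i) \<le> real i powr (-2/2) * cmod (u i)" if "i \<ge> 1" for i
    using that by (simp add: v_def norm_divide powr_minus_divide)
  from ell2_mono[OF u this] have v: "v \<in> ell2 0" and nv: "ell2_norm 0 v \<le> ell2_norm (-2) u"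
    by blast+
  have uv: "u j = of_nat j * v j" if "j \<ge> 1" for j
    using that by (simp add: v_def)
  note Av = op_boundD[OF A v] and NAv = op_boundD[OF NA v]
  have eq: "A i j * (of_nat j * v j) = of_nat i * (A i j * v j) + - (comm_N A i j * v j)" for i j
    by (simp add: comm_N_def algebra_simps)
  \<comment> \<open>The sequence \<open>of_nat j * v j\<close> need not be in \<open>ell2 0\<close>,
    so convergence comes from the commutator identity \<open>eq\<close> rather than from boundedness
    of \<open>A\<close>.\<close>
  have s1: "(\<lambda>j. A i j * (of_nat j * v j)) summable_on {1..}" if "i \<ge> 1" for i
    unfolding eq using Av(1)[OF that] NAv(1)[OF that]
    by (intro summable_on_add summable_on_cmult_right summable_on_uminus[THEN iffD2])
  then show "(\<lambda>j. A i j * u j) summable_on {1..}" if "i \<ge> 1" for i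
    using that by (subst summable_on_cong[of _ _ "\<lambda>j. A i j * (of_nat j * v j)"]) (auto simp: uv)
  have le: "real i powr (-2/2) * cmod (mat_app A u i)
      \<le> real i powr (0/2) * (cmod (mat_app A v i) + cmod (mat_app (comm_N A) v i))" if "i \<ge> 1" for i
  proof -
    have "mat_app A u i = of_nat i * mat_app A v i - mat_app (comm_N A) v i"
      using comm_N_app(1)[of A i v, OF Av(1)[OF that] s1[OF that]] mat_app_cong[OF uv] by simp
    then have "cmod (mat_app A u i) \<le> real i * cmod (mat_app A v i) + cmod (mat_app (comm_N A) v i)"
      using norm_triangle_ineq4[of "of_nat i * mat_app A v i"] by (simp add: norm_mult)
    \<comment> \<open>As \<open>i\<close> is at least 1, the commutator term may also receive the
      factor \<open>i\<close>, which the weight then removes.\<close>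
    also have "\<dots> \<le> real i * cmod (mat_app A v i) + real i * cmod (mat_app (comm_N A) v i)"
      using that mult_right_mono[of 1 "real i" "cmod (mat_app (comm_N A) v i)"] by simp
    finally show ?thesis
      using that by (simp add: powr_minus field_simps)
  qed
  \<comment> \<open>\<open>ell2_mono\<close> compares with a single complex sequence, so the sum of
    the two moduli is read as one.\<close>
  let ?w = "\<lambda>i. of_real (cmod (mat_app A v i)) + of_real (cmod (mat_app (comm_N A) v i)) :: complex"
  have abs: "(\<lambda>i. of_real (cmod (f i)) :: complex) \<in> ell2 0 \<and>
      ell2_norm 0 (\<lambda>i. of_real (cmod (f i))) \<le> ell2_norm 0 f" if "f \<in> ell2 0" for f
    using ell2_mono[OF that, of 0 "\<lambda>i. of_real (cmod (f i))"] by simp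
  note aAv = abs[OF Av(2)] and aNAv = abs[OF NAv(2)]
  have w: "?w \<in> ell2 0"
    using aAv aNAv by (intro ell2_add(1)) blast+
  have "ell2_norm 0 ?w \<le> ell2_norm 0 (mat_app A v) + ell2_norm 0 (mat_app (comm_N A) v)"
    using ell2_add(2)[OF aAv[THEN conjunct1] aNAv[THEN conjunct1]] aAv aNAv by linarith
  also have "\<dots> \<le> K * ell2_norm (-2) u + L * ell2_norm (-2) u"
    using Av(3) NAv(3) mult_left_mono[OF nv K] mult_left_mono[OF nv L] by linarith
  finally have wn: "ell2_norm 0 ?w \<le> (K + L) * ell2_norm (-2) u"
    by (simp add: distrib_right)
  have "real i powr (-2/2) * cmod (mat_app A u i) \<le> real i powr (0/2) * cmod (?w i)" if "i \<ge> 1" for i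
    using le[OF that] by (simp flip: of_real_add)
  from ell2_mono[OF w this] have "mat_app A u \<in> ell2 (-2)"
    and n: "ell2_norm (-2) (mat_app A u) \<le> ell2_norm 0 ?w" by blast+
  then show "mat_app A u \<in> ell2 (-2)" by blast
  show "ell2_norm (-2) (mat_app A u) \<le> (K + L) * ell2_norm (-2) u"
    by (rule order.trans[OF n wn])
qed

text \<open>The bound at 0 is weakened to the constant \<open>K + L\<close> of the endpoints 2 and
  -2, which interpolation preserves; \<open>s\<close> sits at \<theta> = |s|/2 between 0 and the
  endpoint of its sign.\<close>

lemma M_plus_op_bound:
  assumes A: "op_bound 0 K A" and NA: "op_bound 0 L (comm_N A)" and s: "s \<in> {-2..2}"
  shows "op_bound s (K + L) A"
proof -
  have "L \<ge> 0" using NA by (simp add: op_bound_def)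
  then have A0: "op_bound 0 (K + L) A" using A by (rule_tac op_bound_mono) auto
  note A2 = M_plus_op_bound_2[OF A NA] and A2' = M_plus_op_bound_minus_2[OF A NA]
  consider "s = 2" | "s = -2" | "s = 0" | "0 < s" "s < 2" | "-2 < s" "s < 0" using s by force
  then show ?thesis
  proof cases
    case 4
    with op_bound_interpolate[OF A0 A2, of "s/2"] show ?thesis by simp
  next
    case 5
    with op_bound_interpolate[OF A0 A2', of "-s/2"] show ?thesis by simp
  qed (use A0 A2 A2' in auto)
qed

section \<open>The algebras\<close>

lemma norm_alpha_ge:
  assumes "A \<in> M_alpha \<alpha>" "i \<ge> 1" "j \<ge> 1"
  shows "real (min i j) powr \<alpha> * cmod (A i j) \<le> norm_alpha \<alpha> A"
proof -
  have "(case (i, j) of (i, j) \<Rightarrow> real (min i j) powr \<alpha> * cmod (A i j)) \<le> norm_alpha \<alpha> A"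
    unfolding norm_alpha_def by (rule cSUP_upper) (use assms in \<open>auto simp: M_alpha_def\<close>)
  then show ?thesis by simp
qed

lemma norm_alpha_le:
  assumes "\<And>i j. i \<ge> 1 \<Longrightarrow> j \<ge> 1 \<Longrightarrow> real (min i j) powr \<alpha> * cmod (A i j) \<le> K"
  shows "A \<in> M_alpha \<alpha>" and "norm_alpha \<alpha> A \<le> K"
proof -
  show "A \<in> M_alpha \<alpha>"
    unfolding M_alpha_def mem_Collect_eq by (rule bdd_aboveI2[of _ _ K]) (use assms in auto)
  show "norm_alpha \<alpha> A \<le> K"
    unfolding norm_alpha_def by (rule cSUP_least) (use assms in auto)
qed

text \<open>\<open>Delta\<close> shifts both indices by one, which leaves the factor
  \<open>i - j\<close> unchanged.\<close>

lemma comm_N_Delta: "comm_N (Delta A) = Delta (comm_N A)"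
  by (simp add: comm_N_def Delta_def algebra_simps)

text \<open>The derivation rule follows from \<open>i - j = (i - k) + (k - j)\<close> inside the
  sum; the bounds on rows and columns let the two series be summed separately.\<close>

lemma comm_N_mat_mult:
  assumes "rc_bound a A" "rc_bound a' (comm_N A)" "rc_bound b B" "rc_bound b' (comm_N B)" "i \<ge> 1" "j \<ge> 1"
  shows "comm_N (mat_mult A B) i j = mat_mult (comm_N A) B i j + mat_mult A (comm_N B) i j"
proof -
  have "comm_N (mat_mult A B) i j = (\<Sum>\<^sub>\<infinity>k\<in>{1..}. (of_nat i - of_nat j) * (A i k * B k j))"
    by (simp add: comm_N_def mat_mult_def infsum_cmult_right')
  also have "\<dots> = (\<Sum>\<^sub>\<infinity>k\<in>{1..}. comm_N A i k * B k j + A i k * comm_N B k j)"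
    by (rule infsum_cong) (simp add: comm_N_def algebra_simps)
  also have "\<dots> = mat_mult (comm_N A) B i j + mat_mult A (comm_N B) i j"
    unfolding mat_mult_def
    using rc_bound_summable[OF assms(2,3,5,6)] rc_bound_summable[OF assms(1,4,5,6)]
    by (rule infsum_add)
  finally show ?thesis .
qed

text \<open>An upper bound \<open>a\<close> in place of the norm itself lets one constant serve for
  \<open>A\<close> and for its commutator.\<close>

lemma M_hatD:
  assumes "A \<in> M_hat \<alpha>" "norm_hat \<alpha> A \<le> a"
  shows "op_bound 0 a A"
    and "\<And>i j. i \<ge> 1 \<Longrightarrow> j \<ge> 1 \<Longrightarrow> real (min i j) powr \<alpha> * cmod (Delta A i j) \<le> a"
proof -
  show "op_bound 0 a A"
    using assms op_bound_op_norm[of A 0] by (auto simp: M_hat_def M_def norm_hat_def intro: op_bound_mono)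
  show "real (min i j) powr \<alpha> * cmod (Delta A i j) \<le> a" if "i \<ge> 1" "j \<ge> 1" for i j
    using norm_alpha_ge[of "Delta A" \<alpha> i j] assms that by (simp add: M_hat_def norm_hat_def)
qed

lemma M_hatI:
  assumes "op_bound 0 a A"
    and "\<And>i j. i \<ge> 1 \<Longrightarrow> j \<ge> 1 \<Longrightarrow> real (min i j) powr \<alpha> * cmod (Delta A i j) \<le> a"
  shows "A \<in> M_hat \<alpha>" and "norm_hat \<alpha> A \<le> a"
  using op_norm_le[OF assms(1)] norm_alpha_le[of \<alpha> "Delta A" a] assms(2)
  by (auto simp: M_hat_def M_def norm_hat_def)

text \<open>With \<open>norm_hat_plus_eq\<close> this reduces (b) to (a), applied to the product and
  to its commutator; both rest on \<open>comm_N_Delta\<close>.\<close>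

lemma M_hat_plus_iff: "A \<in> M_hat_plus \<alpha> \<longleftrightarrow> A \<in> M_hat \<alpha> \<and> comm_N A \<in> M_hat \<alpha>"
  by (auto simp: M_hat_plus_def M_hat_def M_plus_def M_alpha_plus_def comm_N_Delta)

lemma norm_hat_plus_eq: "norm_hat_plus \<alpha> A = max (norm_hat \<alpha> A) (norm_hat \<alpha> (comm_N A))"
  by (simp add: norm_hat_plus_def norm_hat_def norm_plus_def norm_alpha_plus_def comm_N_Delta max_def)

lemma M_hat_mult:
  assumes \<alpha>: "0 \<le> \<alpha>" "\<alpha> \<le> 1"
    and A: "A \<in> M_hat_plus \<alpha>" "norm_hat_plus \<alpha> A \<le> a" and B: "B \<in> M_hat \<alpha>" "norm_hat \<alpha> B \<le> b"
  shows "mat_mult A B \<in> M_hat \<alpha>" "norm_hat \<alpha> (mat_mult A B) \<le> 13 * a * b"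
    and "mat_mult B A \<in> M_hat \<alpha>" "norm_hat \<alpha> (mat_mult B A) \<le> 13 * a * b"
proof -
  have "A \<in> M_hat \<alpha>" "norm_hat \<alpha> A \<le> a" "comm_N A \<in> M_hat \<alpha>" "norm_hat \<alpha> (comm_N A) \<le> a"
    using A by (auto simp: M_hat_plus_iff norm_hat_plus_eq)
  note A' = M_hatD[OF this(1,2)] and NA = M_hatD[OF this(3,4)] and B' = M_hatD[OF B]
  have ab: "a * b \<le> 13 * a * b" "b * a \<le> 13 * a * b"
    using A'(1) B'(1) by (auto simp: op_bound_def)
  note D = A'(2) NA(2)[folded comm_N_Delta] and rc = op_bound_imp_rc_bound
  show "mat_mult A B \<in> M_hat \<alpha>" "norm_hat \<alpha> (mat_mult A B) \<le> 13 * a * b"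
    using M_hatI[OF op_bound_mono[OF op_bound_mat_mult[OF A'(1) B'(1)] ab(1)]
        Delta_mat_mult_bound[OF \<alpha> rc[OF A'(1)] rc[OF NA(1)] D rc[OF B'(1)] B'(2)]] by blast+
  show "mat_mult B A \<in> M_hat \<alpha>" "norm_hat \<alpha> (mat_mult B A) \<le> 13 * a * b"
    using M_hatI[OF op_bound_mono[OF op_bound_mat_mult[OF B'(1) A'(1)] ab(2)]
        Delta_mat_mult_bound_right[OF \<alpha> rc[OF A'(1)] rc[OF NA(1)] D rc[OF B'(1)] B'(2)]] by blast+
qed

lemma M_hat_plus_mult:
  assumes \<alpha>: "0 \<le> \<alpha>" "\<alpha> \<le> 1"
    and A: "A \<in> M_hat_plus \<alpha>" "norm_hat_plus \<alpha> A \<le> a"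
    and B: "B \<in> M_hat_plus \<alpha>" "norm_hat_plus \<alpha> B \<le> b"
  shows "mat_mult A B \<in> M_hat_plus \<alpha>" "norm_hat_plus \<alpha> (mat_mult A B) \<le> 26 * a * b"
proof -
  have A': "A \<in> M_hat \<alpha>" "norm_hat \<alpha> A \<le> a" "comm_N A \<in> M_hat \<alpha>" "norm_hat \<alpha> (comm_N A) \<le> a"
    and B': "B \<in> M_hat \<alpha>" "norm_hat \<alpha> B \<le> b" "comm_N B \<in> M_hat \<alpha>" "norm_hat \<alpha> (comm_N B) \<le> b"
    using A B by (auto simp: M_hat_plus_iff norm_hat_plus_eq)
  note rc = op_bound_imp_rc_bound[OF M_hatD(1)]
  note AB = M_hat_mult(1,2)[OF \<alpha> A B'(1,2)]
  \<comment> \<open>In \<open>X\<close> the roles are exchanged: \<open>B\<close> is the factor in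
    \<open>M_hat_plus \<alpha>\<close>, while \<open>comm_N A\<close> is only known to be in
    \<open>M_hat \<alpha>\<close>. Each of \<open>X\<close> and \<open>Y\<close> costs 13, hence
    26.\<close>
  note X = M_hatD[OF M_hat_mult(3,4)[OF \<alpha> B A'(3,4)]] and Y = M_hatD[OF M_hat_mult(1,2)[OF \<alpha> A B'(3,4)]]
  have ab: "0 \<le> a * b"
    using M_hatD(1)[OF A'(1,2)] M_hatD(1)[OF B'(1,2)] by (simp add: op_bound_def)
  have eq: "comm_N (mat_mult A B) i j = mat_mult (comm_N A) B i j + mat_mult A (comm_N B) i j"
    if "i \<ge> 1" "j \<ge> 1" for i j
    by (rule comm_N_mat_mult[OF rc[OF A'(1,2)] rc[OF A'(3,4)] rc[OF B'(1,2)] rc[OF B'(3,4)] that])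
  have "op_bound 0 (13 * b * a + 13 * a * b) (\<lambda>i j. mat_mult (comm_N A) B i j + mat_mult A (comm_N B) i j)"
    by (rule op_bound_add[OF X(1) Y(1)])
  then have ob: "op_bound 0 (26 * a * b) (comm_N (mat_mult A B))"
    by (rule op_bound_mono[OF op_bound_cong]) (auto simp: eq)
  have "real (min i j) powr \<alpha> * cmod (Delta (comm_N (mat_mult A B)) i j) \<le> 26 * a * b"
    if ij: "i \<ge> 1" "j \<ge> 1" for i j
  proof -
    have "Delta (comm_N (mat_mult A B)) i j = Delta (mat_mult (comm_N A) B) i j + Delta (mat_mult A (comm_N B)) i j"
      using ij by (simp add: Delta_def eq)
    then have "real (min i j) powr \<alpha> * cmod (Delta (comm_N (mat_mult A B)) i j)
        \<le> real (min i j) powr \<alpha> * (cmod (Delta (mat_mult (comm_N A) B) i j) + cmod (Delta (mat_mult A (comm_N B)) i j))"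
      by (auto intro!: mult_left_mono norm_triangle_ineq)
    also have "\<dots> \<le> 26 * a * b"
      using X(2)[OF ij] Y(2)[OF ij] by (simp add: distrib_left mult_ac)
    finally show ?thesis .
  qed
  from M_hatI[OF ob this]
  have N: "comm_N (mat_mult A B) \<in> M_hat \<alpha>" "norm_hat \<alpha> (comm_N (mat_mult A B)) \<le> 26 * a * b"
    by blast+
  show "mat_mult A B \<in> M_hat_plus \<alpha>"
    using AB N by (simp add: M_hat_plus_iff)
  show "norm_hat_plus \<alpha> (mat_mult A B) \<le> 26 * a * b"
    using AB N ab by (simp add: norm_hat_plus_eq)
qed

text \<open>The difference telescopes: every increment from \<open>i\<close> to \<open>j\<close> is
  a diagonal entry of \<open>Delta (diag_mat d)\<close>, and its weight is at least
  \<open>real i powr \<alpha>\<close>.\<close>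

lemma diag_increment_bound:
  assumes d: "Delta (diag_mat d) \<in> M_alpha \<alpha>" and \<alpha>: "0 \<le> \<alpha>" and ij: "i \<ge> 1" "j \<ge> i"
  shows "cmod (d j - d i) \<le> norm_alpha \<alpha> (Delta (diag_mat d)) * ((real j - real i) / real i powr \<alpha>)"
proof -
  let ?K = "norm_alpha \<alpha> (Delta (diag_mat d))"
  have K: "?K \<ge> 0"
    by (rule order.trans[OF _ norm_alpha_ge[OF d, of 1 1]]) auto
  show ?thesis
    using ij(2)
  proof (induction j rule: dec_induct)
    case base
    show ?case by simp
  next
    case (step n)
    have n: "n \<ge> 1" using step.hyps ij by simp
    have "real n powr \<alpha> * cmod (d (Suc n) - d n) \<le> ?K"
      using norm_alpha_ge[OF d n n] by (simp add: Delta_def diag_mat_def)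
    then have "cmod (d (Suc n) - d n) \<le> ?K / real n powr \<alpha>"
      using n by (simp add: field_simps)
    also have "\<dots> \<le> ?K / real i powr \<alpha>"
      using step.hyps ij K \<alpha> by (intro divide_left_mono powr_mono2) auto
    finally have "cmod (d (Suc n) - d i) \<le> ?K / real i powr \<alpha> + ?K * ((real n - real i) / real i powr \<alpha>)"
      using step.IH norm_triangle_ineq[of "d (Suc n) - d n" "d n - d i"] by simp
    then show ?case
      by (simp add: add_divide_distrib diff_divide_distrib algebra_simps)
  qed
qed

theorem lemma2p2:
  fixes \<alpha> :: real
  assumes "0 \<le> \<alpha>" and "\<alpha> \<le> 1"
  shows "\<exists>C::real. C > 0 \<and>
    (\<forall>A B. A \<in> M_hat_plus \<alpha> \<longrightarrow> B \<in> M_hat \<alpha> \<longrightarrow>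
       mat_mult A B \<in> M_hat \<alpha> \<and> mat_mult B A \<in> M_hat \<alpha> \<and>
       norm_hat \<alpha> (mat_mult A B) \<le> C * norm_hat_plus \<alpha> A * norm_hat \<alpha> B \<and>
       norm_hat \<alpha> (mat_mult B A) \<le> C * norm_hat_plus \<alpha> A * norm_hat \<alpha> B) \<and>
    (\<forall>A B. A \<in> M_hat_plus \<alpha> \<longrightarrow> B \<in> M_hat_plus \<alpha> \<longrightarrow>
       mat_mult A B \<in> M_hat_plus \<alpha> \<and>
       norm_hat_plus \<alpha> (mat_mult A B) \<le> C * norm_hat_plus \<alpha> A * norm_hat_plus \<alpha> B) \<and>
    (\<forall>A. A \<in> M_plus \<longrightarrow>
       (\<forall>s\<in>{-2..2}. A \<in> bounded_mats s \<and> op_norm s A \<le> C * norm_plus A)) \<and>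
    (\<forall>d::cseq. Delta (diag_mat d) \<in> M_alpha \<alpha> \<longrightarrow>
       (\<forall>i\<ge>1. \<forall>j\<ge>1. cmod (d i - d j)
          \<le> norm_alpha \<alpha> (Delta (diag_mat d)) * (\<bar>real i - real j\<bar> / real (min i j) powr \<alpha>)))"
proof (intro exI[of _ 26] conjI allI impI ballI)
  \<comment> \<open>The largest of the constants obtained: 13 in (a), 26 in (b), and 2 in (c), where
    a sum of two norms is compared with their maximum.\<close>
  show "(26::real) > 0" by simp
next
  fix A B assume A: "A \<in> M_hat_plus \<alpha>" and B: "B \<in> M_hat \<alpha>"
  let ?a = "norm_hat_plus \<alpha> A" and ?b = "norm_hat \<alpha> B"
  note m = M_hat_mult[OF assms A order.refl B order.refl]
  show "mat_mult A B \<in> M_hat \<alpha>" "mat_mult B A \<in> M_hat \<alpha>" by (rule m)+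
  have "op_bound 0 ?a A" "op_bound 0 ?b B"
    using A B by (auto simp: M_hat_plus_iff norm_hat_plus_eq intro!: M_hatD(1))
  then have "13 * ?a * ?b \<le> 26 * ?a * ?b"
    by (simp add: op_bound_def mult_right_mono)
  then show "norm_hat \<alpha> (mat_mult A B) \<le> 26 * ?a * ?b" "norm_hat \<alpha> (mat_mult B A) \<le> 26 * ?a * ?b"
    using m by linarith+
next
  fix A B assume A: "A \<in> M_hat_plus \<alpha>" and B: "B \<in> M_hat_plus \<alpha>"
  show "mat_mult A B \<in> M_hat_plus \<alpha>"
    "norm_hat_plus \<alpha> (mat_mult A B) \<le> 26 * norm_hat_plus \<alpha> A * norm_hat_plus \<alpha> B"
    by (rule M_hat_plus_mult[OF assms A order.refl B order.refl])+
next
  fix A s assume A: "A \<in> M_plus" and s: "s \<in> {-2..2::real}"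
  have n: "op_bound 0 (op_norm 0 A) A" "op_bound 0 (op_norm 0 (comm_N A)) (comm_N A)"
    using A by (auto simp: M_plus_def M_def intro!: op_bound_op_norm)
  have "op_norm 0 A + op_norm 0 (comm_N A) \<le> 26 * norm_plus A"
    using n by (auto simp: norm_plus_def op_bound_def max_def)
  then have "op_bound s (26 * norm_plus A) A"
    by (rule op_bound_mono[OF M_plus_op_bound[OF n s]])
  then show "A \<in> bounded_mats s" "op_norm s A \<le> 26 * norm_plus A"
    by (rule op_norm_le)+
next
  fix d :: cseq and i j :: nat
  assume d: "Delta (diag_mat d) \<in> M_alpha \<alpha>" and ij: "i \<ge> 1" "j \<ge> 1"
  show "cmod (d i - d j) \<le> norm_alpha \<alpha> (Delta (diag_mat d)) * (\<bar>real i - real j\<bar> / real (min i j) powr \<alpha>)"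
  proof (cases "i \<le> j")
    case True
    with diag_increment_bound[OF d assms(1) ij(1)] show ?thesis
      by (simp add: norm_minus_commute[of "d i"] min_absorb1)
  next
    case False
    with diag_increment_bound[OF d assms(1) ij(2), of i] show ?thesis
      by (simp add: min_absorb2)
  qed
qed

end
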